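(* Let $T>0$, let $d,q,M\ge 1$ be integers, $p\in[2,+\infty)$, and let $b:[0,T]\times\mathbb{R}^d\times\mathcal{P}_p(\mathbb{R}^d)\to\mathbb{R}^d$ and $\sigma,\theta:[0,T]\times\mathbb{R}^d\times\mathcal{P}_p(\mathbb{R}^d)\to\mathbb{M}_{d\times q}$. Let $X_0,Y_0\in L^p(\mathbb{P})$ be $\mathbb{R}^d$-valued. Assume (I): there are $\rho\in(0,1]$ and $L,\tilde L>0$ such that for all $0\le s\le t\le T$, $x,y\in\mathbb{R}^d$, $\mu,\nu\in\mathcal{P}_p(\mathbb{R}^d)$, and for each $f\in\{b,\sigma,\theta\}$ (with the Euclidean norm for $b$ and the operator norm for $\sigma,\theta$), $$\|f(t,x,\mu)-f(s,x,\mu)\|\le \tilde L\big(1+|x|+\mathcal{W}_p(\mu,\delta_0)\big)(t-s)^\rho,\qquad \|f(t,x,\mu)-f(t,y,\nu)\|\le L\big(|x-y|+\mathcal{W}_p(\mu,\nu)\big).$$ Assume (II): (1) $b(t,\cdot,\mu)$ is affine for all $(t,\mu)$, and $b(t,x,\mu)=b(t,x,\nu)$ for all $(t,x)$ whenever $\mu,\nu\in\mathcal{P}_p(\mathbb{R}^d)$, $\mu\preceq_{cv}\nu$; (2) $\sigma(t,\lambda x+(1-\lambda)y,\mu)\preceq\lambda\sigma(t,x,\mu)+(1-\lambda)\sigma(t,y,\mu)$ for all $t\in[0,T]$, $\mu\in\mathcal{P}_p(\mathbb{R}^d)$, $x,y\in\mathbb{R}^d$, $\lambda\in[0,1]$;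 (3) $\sigma(t,x,\mu)\preceq\sigma(t,x,\nu)$ for all $(t,x)$ whenever $\mu,\nu\in\mathcal{P}_p(\mathbb{R}^d)$, $\mu\preceq_{cv}\nu$; (4) $\sigma(t,x,\mu)\preceq\theta(t,x,\mu)$ for all $(t,x,\mu)$; (5) $X_0\preceq_{cv}Y_0$. Let $(\bar X_m)_{0\le m\le M}$ and $(\bar Y_m)_{0\le m\le M}$ be the Euler schemes: with $h=T/M$, $t_m=mh$, $\bar X_0=X_0$, $\bar Y_0=Y_0$ and, for $m=0,\dots,M-1$, $$\bar X_{m+1}=\bar X_m+h\,b(t_m,\bar X_m,\bar\mu_m)+\sqrt h\,\sigma(t_m,\bar X_m,\bar\mu_m)Z_{m+1},\qquad \bar Y_{m+1}=\bar Y_m+h\,b(t_m,\bar Y_m,\bar\nu_m)+\sqrt h\,\theta(t_m,\bar Y_m,\bar\nu_m)Z_{m+1},$$ where $\bar\mu_m,\bar\nu_m$ are the distributions of $\bar X_m,\bar Y_m$, and $Z_1,\dots,Z_M$ are i.i.d. $\mathcal{N}(0,\mathbf{I}_q)$, independent of $(X_0,Y_0)$. Then for every convex function $F:(\mathbb{R}^d)^{M+1}\to\mathbb{R}$ for which there is $C>0$ with $|F(x_0,\dots,x_M)|\le C\big(1+\sup_{0\le i\le M}|x_i|^p\big)$ for all $(x_0,\dots,x_M)\in(\mathbb{R}^d)^{M+1}$, $$\mathbb{E}F(\bar X_0,\dots,\bar X_M)\le\mathbb{E}F(\bar Y_0,\dots,\bar Y_M).$$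
   Context: All random variables live on a probability space $(\Omega,\mathcal{F},\mathbb{P})$. $\mathbb{M}_{d\times q}$ is the set of real $d\times q$ matrices with operator norm $\sup_{|z|\le1}|Az|$; for $A,B\in\mathbb{M}_{d\times q}$, $A\preceq B$ means that $BB^\top-AA^\top$ is positive semi-definite. $\mathcal{P}_p(\mathbb{R}^d)$ is the set of probability distributions on $\mathbb{R}^d$ with finite $p$-th moment, $\mathcal{W}_p$ is the $L^p$-Wasserstein distance (for the Euclidean norm $|\cdot|$), $\delta_0$ is the Dirac mass at $0$. Convex order: for $\mu,\nu\in\mathcal{P}_1(\mathbb{R}^d)$, $\mu\preceq_{cv}\nu$ means $\int\varphi\,d\mu\le\int\varphi\,d\nu$ for every convex $\varphi:\mathbb{R}^d\to\mathbb{R}$ (integrals in $(-\infty,+\infty]$); for integrable random variables, $U\preceq_{cv}V$ means that their distributions are so ordered. (In the paper $Z_{m+1}=(B_{t_{m+1}}-B_{t_m})/\sqrt h$ for a $q$-dimensional Brownian motion $B$.) *)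

theory Defs
  imports "HOL-Probability.Probability"
begin

definition prob_moment :: "real \<Rightarrow> 'a::euclidean_space measure set" where
  "prob_moment p =
     {\<mu>. sets \<mu> = sets borel \<and> prob_space \<mu> \<and> integrable \<mu> (\<lambda>x. norm x powr p)}"

definition couplings ::
    "'a::euclidean_space measure \<Rightarrow> 'a measure \<Rightarrow> ('a \<times> 'a) measure set" where
  "couplings \<mu> \<nu> =
     {\<pi>. sets \<pi> = sets (borel \<Otimes>\<^sub>M borel) \<and> distr \<pi> borel fst = \<mu> \<and> distr \<pi> borel snd = \<nu>}"

(* Meant for mu, nu in prob_moment p: there the infimum is finite, so enn2real loses nothing. *)
definition wasserstein :: "real \<Rightarrow> 'a::euclidean_space measure \<Rightarrow> 'a measure \<Rightarrow> real" where
  "wasserstein p \<mu> \<nu> =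
     enn2real (INF \<pi>\<in>couplings \<mu> \<nu>. \<integral>\<^sup>+ z. ennreal (norm (fst z - snd z) powr p) \<partial>\<pi>) powr (1 / p)"

(* Integral of the positive part minus integral of the negative part (ennreal truncates negative
   reals to 0). A convex function has an affine minorant, so for mu in prob_moment 1 the
   subtrahend is finite and the value lies in (-\<infinity>, \<infinity>]. *)
definition ext_integral :: "'a measure \<Rightarrow> ('a \<Rightarrow> real) \<Rightarrow> ereal" where
  "ext_integral \<mu> f =
     enn2ereal (\<integral>\<^sup>+ x. ennreal (f x) \<partial>\<mu>) - enn2ereal (\<integral>\<^sup>+ x. ennreal (- f x) \<partial>\<mu>)"

definition convex_order :: "'a::euclidean_space measure \<Rightarrow> 'a measure \<Rightarrow> bool"
    (infix "\<preceq>cv" 50) where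
  "\<mu> \<preceq>cv \<nu> \<longleftrightarrow> \<mu> \<in> prob_moment 1 \<and> \<nu> \<in> prob_moment 1 \<and>
     (\<forall>\<phi>. convex_on UNIV \<phi> \<longrightarrow> ext_integral \<mu> \<phi> \<le> ext_integral \<nu> \<phi>)"

(* The type-class norm on real ^ 'q ^ 'd is the Frobenius norm, not the operator norm. *)
definition op_norm :: "real ^ 'q ^ 'd \<Rightarrow> real" where
  "op_norm A = onorm (\<lambda>z. A *v z)"

definition pos_semidef :: "real ^ 'd ^ 'd \<Rightarrow> bool" where
  "pos_semidef S \<longleftrightarrow> transpose S = S \<and> (\<forall>v. 0 \<le> v \<bullet> (S *v v))"

definition matrix_order :: "real ^ 'q ^ 'd \<Rightarrow> real ^ 'q ^ 'd \<Rightarrow> bool"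
    (infix "\<preceq>mat" 50) where
  "A \<preceq>mat B \<longleftrightarrow> pos_semidef (B ** transpose B - A ** transpose A)"

definition affine_fun :: "('a::real_vector \<Rightarrow> 'b::real_vector) \<Rightarrow> bool" where
  "affine_fun f \<longleftrightarrow> (\<exists>g c. linear g \<and> (\<forall>x. f x = g x + c))"

(* A coefficient (t, x, mu) \<mapsto> f t x mu is only meaningful for t in [0, T] and
   mu in prob_moment p. *)
type_synonym ('a, 'b) coefficient = "real \<Rightarrow> 'a \<Rightarrow> 'a measure \<Rightarrow> 'b"

(* N is the norm used on the values of the coefficient. *)
definition regular_coefficient ::
    "real \<Rightarrow> real \<Rightarrow> real \<Rightarrow> real \<Rightarrow> real \<Rightarrow> ('b \<Rightarrow> real) \<Rightarrow>
     ('a::euclidean_space, 'b::real_vector) coefficient \<Rightarrow> bool" where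
  "regular_coefficient T p \<rho> L L' N f \<longleftrightarrow>
     (\<forall>s t x y. \<forall>\<mu>\<in>prob_moment p. \<forall>\<nu>\<in>prob_moment p. 0 \<le> s \<and> s \<le> t \<and> t \<le> T \<longrightarrow>
        N (f t x \<mu> - f s x \<mu>)
          \<le> L' * (1 + norm x + wasserstein p \<mu> (return borel 0)) * (t - s) powr \<rho> \<and>
        N (f t x \<mu> - f t y \<nu>) \<le> L * (norm (x - y) + wasserstein p \<mu> \<nu>))"

definition std_normal_vec :: "(real ^ 'q) measure" where
  "std_normal_vec =
     density lborel (\<lambda>z. ennreal (exp (- (norm z)\<^sup>2 / 2) / sqrt (2 * pi) ^ CARD('q)))"

(* The library's indep_var requires both variables to have the same value type. *)
definition indep_pair ::
    "'w measure \<Rightarrow> 'a measure \<Rightarrow> ('w \<Rightarrow> 'a) \<Rightarrow> 'b measure \<Rightarrow> ('w \<Rightarrow> 'b) \<Rightarrow> bool" where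
  "indep_pair P S U S' V \<longleftrightarrow>
     U \<in> measurable P S \<and> V \<in> measurable P S' \<and>
     prob_space.indep_set P {U -` A \<inter> space P | A. A \<in> sets S} {V -` A \<inter> space P | A. A \<in> sets S'}"

primrec euler_scheme ::
    "'w measure \<Rightarrow> real \<Rightarrow> (real ^ 'd, real ^ 'd) coefficient \<Rightarrow>
     (real ^ 'd, real ^ 'q ^ 'd) coefficient \<Rightarrow> ('w \<Rightarrow> real ^ 'd) \<Rightarrow>
     (nat \<Rightarrow> 'w \<Rightarrow> real ^ 'q) \<Rightarrow> nat \<Rightarrow> 'w \<Rightarrow> real ^ 'd" where
  "euler_scheme P h b \<sigma> X0 Z 0 = X0"
| "euler_scheme P h b \<sigma> X0 Z (Suc m) =
     (let X = euler_scheme P h b \<sigma> X0 Z m; \<mu> = distr P borel X; t = real m * h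
      in (\<lambda>\<omega>. X \<omega> + h *\<^sub>R b t (X \<omega>) \<mu> + sqrt h *\<^sub>R (\<sigma> t (X \<omega>) \<mu> *v Z (Suc m) \<omega>)))"

(* An element (x_0, ..., x_M) of the (M+1)-fold product is an extensional function on {..M}.
   As nat \<Rightarrow> 'a is not an instance of real_vector, convex_on does not apply, and the convexity
   inequality is stated with the coordinatewise vector operations. *)
definition path_space :: "nat \<Rightarrow> (nat \<Rightarrow> 'a) set" where
  "path_space M = ({..M} \<rightarrow>\<^sub>E UNIV)"

definition convex_on_paths :: "nat \<Rightarrow> ((nat \<Rightarrow> 'a::real_vector) \<Rightarrow> real) \<Rightarrow> bool" where
  "convex_on_paths M F \<longleftrightarrow>
     (\<forall>x\<in>path_space M. \<forall>y\<in>path_space M. \<forall>u\<in>{0..1}.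
        F (\<lambda>i\<in>{..M}. u *\<^sub>R x i + (1 - u) *\<^sub>R y i) \<le> u * F x + (1 - u) * F y)"

definition poly_growth_on_paths ::
    "nat \<Rightarrow> real \<Rightarrow> ((nat \<Rightarrow> 'a::real_normed_vector) \<Rightarrow> real) \<Rightarrow> bool" where
  "poly_growth_on_paths M p F \<longleftrightarrow>
     (\<exists>C>0. \<forall>x\<in>path_space M. \<bar>F x\<bar> \<le> C * (1 + (MAX i\<in>{..M}. norm (x i) powr p)))"

end

(* Induction on the number of steps, for all convex functionals of polynomial growth of the path at
   once. Conditioning on the first m steps turns a functional F of X_0, ..., X_(m+1) into
   G(x) = E F(x_0, ..., x_m, beta(x_m) + S(x_m) Z), which is convex again because beta is affine, S is
   convex for the matrix order and A |-> E psi(a + A Z) is monotone for this order when psi is convex.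
   The induction hypothesis exchanges X for Y in E G; the same monotonicity then exchanges sigma for
   theta pointwise, since the induction hypothesis also orders the marginal laws.
   The Gaussian monotonicity: A A^T <= B B^T gives A = B K with a contraction K, contractions are
   convex combinations of orthogonal matrices (Krein-Milman), and Z is rotation invariant. *)
theory Submission
  imports Defs
begin

text \<open>The coefficients depend on the laws of the schemes, which differ for X and Y. Inside one
  step these laws are fixed parameters, and the hypotheses on measures can be used only once the
  marginal laws are known to be in convex order. That order is tested against every convex function,
  even one with infinite integral, whereas the induction controls functionals of growth
  \<open>p\<close>. The gap is closed by regularization: a convex function is the increasing limit
  of its infimal convolutions with multiples of the norm, which are convex of linear growth.

  Convexity in the state is assumed for \<open>\<sigma>\<close>, so the functional handed to the
  induction hypothesis is built from \<open>\<sigma>\<close> and the law of X;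
  \<open>\<theta>\<close> and the law of Y enter afterwards, path by path. The drift admits no
  comparison of this kind, since the functionals are not monotone: it has to be equal in both
  schemes, which the invariance of \<open>b\<close> under the convex order provides.

  That the Gaussian density has total mass 1 is not computed: it is the law of
  \<open>Z m\<close>.\<close>

section \<open>Contractions\<close>

text \<open>As a rewrite rule it turns \<open>transpose A *v x\<close> into \<open>x v* A\<close>;
  the arguments below keep the transpose as a matrix acting from the left.\<close>

declare transpose_matrix_vector [simp del]

definition contractions :: "(real ^ 'q ^ 'q) set" where
  "contractions = {K. \<forall>x. norm (K *v x) \<le> norm x}"

lemma inner_mult_transpose: "((A::real^'q^'d) *v x) \<bullet> y = x \<bullet> (transpose A *v y)"
  by (metis dot_lmul_matrix inner_commute transpose_matrix_vector)

text \<open>The transpose enters three times below: the rows of \<open>K\<close> are columns of its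
  transpose, the defect of \<open>K\<close> from an isometry contains it, and the factorization is
  found for \<open>transpose A\<close> and then transposed.\<close>

lemma norm_transpose_contraction:
  assumes "K \<in> contractions" shows "norm (transpose K *v x) \<le> norm x"
proof -
  have "(norm (transpose K *v x))\<^sup>2 = (K *v (transpose K *v x)) \<bullet> x"
    by (simp add: inner_mult_transpose power2_norm_eq_inner)
  also have "\<dots> \<le> norm (K *v (transpose K *v x)) * norm x"
    by (rule norm_cauchy_schwarz)
  also have "\<dots> \<le> norm (transpose K *v x) * norm x"
    using assms by (intro mult_right_mono) (auto simp: contractions_def)
  finally show ?thesis
    by (cases "norm (transpose K *v x) = 0") (simp_all add: power2_eq_square)
qed

lemma convex_contractions: "convex (contractions :: (real ^ 'q ^ 'q) set)"
proof (rule convexI)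
  fix K N :: "real^'q^'q" and u v :: real
  assume K: "K \<in> contractions" and N: "N \<in> contractions" and uv: "0 \<le> u" "0 \<le> v" "u + v = 1"
  have "norm ((u *\<^sub>R K + v *\<^sub>R N) *v x) \<le> norm x" for x
  proof -
    have "norm ((u *\<^sub>R K + v *\<^sub>R N) *v x) \<le> u * norm (K *v x) + v * norm (N *v x)"
      using uv norm_triangle_ineq[of "u *\<^sub>R (K *v x)" "v *\<^sub>R (N *v x)"]
      by (simp add: matrix_vector_mult_add_rdistrib flip: scaleR_matrix_vector_assoc)
    also have "\<dots> \<le> u * norm x + v * norm x"
      using K N uv by (intro add_mono mult_left_mono) (auto simp: contractions_def)
    finally show ?thesis using uv by (simp flip: distrib_right)
  qed
  then show "u *\<^sub>R K + v *\<^sub>R N \<in> contractions"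
    by (simp add: contractions_def)
qed

lemma compact_contractions: "compact (contractions :: (real ^ 'q ^ 'q) set)"
proof -
  have "contractions = (\<Inter>x. {K :: real^'q^'q. norm (K *v x) \<le> norm x})"
    by (auto simp: contractions_def)
  moreover have "closed {K :: real^'q^'q. norm (K *v x) \<le> norm x}" for x
  proof (intro closed_Collect_le continuous_intros)
    have "linear (\<lambda>K :: real^'q^'q. K *v x)"
      by (simp add: linear_iff matrix_vector_mult_add_rdistrib scaleR_matrix_vector_assoc)
    then show "continuous_on UNIV (\<lambda>K :: real^'q^'q. K *v x)"
      by (simp add: linear_continuous_on linear_conv_bounded_linear)
  qed
  ultimately have "closed (contractions :: (real ^ 'q ^ 'q) set)"
    using closed_INT[of UNIV "\<lambda>x. {K :: real^'q^'q. norm (K *v x) \<le> norm x}"] by simp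
  moreover have "bounded (contractions :: (real ^ 'q ^ 'q) set)"
  proof (rule boundedI)
    fix K :: "real^'q^'q" assume K: "K \<in> contractions"
    \<comment> \<open>The \<open>i\<close>-th row of \<open>K\<close> is the image of the
      \<open>i\<close>-th unit vector under the transpose, so it has norm at most 1.\<close>
    have "norm K = L2_set (\<lambda>i. norm (transpose K *v axis i 1)) UNIV"
      by (simp add: norm_vec_def matrix_vector_mult_basis column_def transpose_def)
    also have "\<dots> \<le> (\<Sum>i\<in>UNIV. norm (transpose K *v axis i 1))"
      by (rule L2_set_le_sum) auto
    also have "\<dots> \<le> (\<Sum>i\<in>(UNIV::'q set). 1)"
      by (intro sum_mono) (use norm_transpose_contraction[OF K] in \<open>metis norm_axis_1\<close>)
    finally show "norm K \<le> CARD('q)" by simp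
  qed
  ultimately show ?thesis by (simp add: compact_eq_bounded_closed)
qed

lemma not_extreme_point_ofI:
  fixes x e :: "'a::real_vector"
  assumes "x + e \<in> S" "x - e \<in> S" "e \<noteq> 0"
  shows "\<not> x extreme_point_of S"
proof
  assume "x extreme_point_of S"
  moreover have "x \<in> open_segment (x - e) (x + e)"
  proof -
    have "e + e \<noteq> 0" using assms by (simp flip: scaleR_2)
    then show ?thesis
      by (auto simp: in_segment algebra_simps intro!: exI[of _ "1/2"] simp flip: scaleR_left_distrib)
  qed
  ultimately show False using assms by (auto simp: extreme_point_of_def)
qed

text \<open>A contraction that is not injective can be perturbed by \<open>\<plusminus>u v\<^sup>T\<close> with \<open>v\<close> in its kernel and
  \<open>u\<close> orthogonal to its range, an injective one by \<open>\<plusminus>K (1 - K\<^sup>T K) / 4\<close>.\<close>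

lemma extreme_contraction_orthogonal:
  fixes K :: "real^'q^'q"
  assumes "K extreme_point_of contractions"
  shows "orthogonal_matrix K"
proof -
  have K: "K \<in> contractions" using assms by (simp add: extreme_point_of_def)
  have ineq: "norm (K *v x) \<le> norm x" for x using K by (simp add: contractions_def)
  have inj: "inj ((*v) K)"
  proof (rule ccontr)
    assume n: "\<not> inj ((*v) K)"
    then obtain v0 where v0: "K *v v0 = 0" "v0 \<noteq> 0"
      by (auto simp: linear_injective_0[OF matrix_vector_mul_linear])
    define v where "v = (1 / norm v0) *\<^sub>R v0"
    have v: "K *v v = 0" "norm v = 1"
      using v0 by (auto simp: v_def matrix_vector_mult_scaleR)
    have "\<not> surj ((*v) K)"
      using n linear_surjective_imp_injective[OF matrix_vector_mul_linear] by blast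
    then have "span (range ((*v) K)) \<subset> UNIV"
      using linear_subspace_image[OF matrix_vector_mul_linear subspace_UNIV, of K]
      by (auto simp: span_eq_iff[THEN iffD2] psubset_eq)
    then obtain u0 where u0: "u0 \<noteq> 0" "\<And>y. y \<in> span (range ((*v) K)) \<Longrightarrow> orthogonal u0 y"
      using orthogonal_to_subspace_exists_gen[of "range ((*v) K)" "UNIV"] by auto
    define u where "u = (1 / norm u0) *\<^sub>R u0"
    have u: "norm u = 1" "u \<bullet> (K *v x) = 0" for x
      using u0(1) u0(2)[of "K *v x"] by (auto simp: u_def orthogonal_def span_base)
    define E where "E = (\<chi> i j. u $ i * v $ j)"
    have E: "E *v x = (v \<bullet> x) *\<^sub>R u" for x
      by (simp add: E_def matrix_vector_mult_def vec_eq_iff inner_vec_def sum_distrib_left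
          sum_distrib_right mult_ac)
    have "norm (K *v x + c *\<^sub>R (E *v x)) \<le> norm x" if "c\<^sup>2 = 1" for x c
    proof -
      \<comment> \<open>\<open>K\<close> sees only the part \<open>w\<close> of \<open>x\<close>
        orthogonal to the kernel vector \<open>v\<close>. Passing from \<open>x\<close> to
        \<open>w\<close> frees exactly \<open>(v \<bullet> x)\<^sup>2\<close> of squared length,
        which pays for the added term in direction \<open>u\<close>.\<close>
      define w where "w = x - (v \<bullet> x) *\<^sub>R v"
      have Kw: "K *v w = K *v x"
        by (simp add: w_def matrix_vector_mult_diff_distrib matrix_vector_mult_scaleR v)
      have vv: "v \<bullet> v = 1" "u \<bullet> u = 1" using v u by (auto simp: norm_eq_1)
      have "(norm (K *v x + c *\<^sub>R (E *v x)))\<^sup>2 = (norm (K *v w))\<^sup>2 + (v \<bullet> x)\<^sup>2 * c\<^sup>2"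
        using u(2)[of x] vv unfolding Kw E power2_norm_eq_inner
        by (simp add: inner_add inner_commute power2_eq_square)
      also have "\<dots> \<le> (norm w)\<^sup>2 + (v \<bullet> x)\<^sup>2"
        using ineq[of w] that by (simp add: power_mono)
      also have "\<dots> = (norm x)\<^sup>2"
        using vv unfolding w_def power2_norm_eq_inner
        by (simp add: inner_diff inner_commute power2_eq_square)
      finally show ?thesis by (rule power2_le_imp_le) simp
    qed
    from this[of 1] this[of "-1"] have "K + E \<in> contractions" "K - E \<in> contractions"
      by (auto simp: contractions_def matrix_vector_mult_add_rdistrib matrix_vector_mult_diff_rdistrib)
    moreover have "E \<noteq> 0"
    proof
      assume "E = 0"
      then have "E *v v = 0" by simp
      moreover have "E *v v = u" using v by (simp add: E norm_eq_1)
      ultimately show False using u by auto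
    qed
    ultimately show False using not_extreme_point_ofI assms by blast
  qed
  define D where "D = mat 1 - transpose K ** K"
  have D: "D *v x = x - transpose K *v (K *v x)" for x
    by (simp add: D_def matrix_vector_mult_diff_rdistrib matrix_vector_mul_assoc)
  define E where "E = (1/4) *\<^sub>R (K ** D)"
  have E: "E *v x = (1/4) *\<^sub>R (K *v (D *v x))" for x
    by (simp add: E_def matrix_vector_mul_assoc scaleR_matrix_vector_assoc)
  have "norm (K *v x + c *\<^sub>R (E *v x)) \<le> norm x" if c: "c = 1 \<or> c = -1" for x c
  proof -
    define y where "y = D *v x"
    define S where "S = transpose K *v (K *v x)"
    have xS: "x = y + S" by (simp add: y_def S_def D)
    have 1: "(K *v x) \<bullet> (K *v x) = x \<bullet> S" by (simp add: S_def inner_mult_transpose)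
    have 2: "(K *v x) \<bullet> (K *v y) = S \<bullet> y"

      using inner_mult_transpose[of K y "K *v x"] by (simp add: S_def inner_commute)
    have 3: "norm S \<le> norm (K *v x)" using norm_transpose_contraction[OF K] by (simp add: S_def)
    have 4: "norm (K *v y) \<le> norm y" by (rule ineq)
    have a: "S \<bullet> S \<le> x \<bullet> S" using 3 by (simp add: norm_le 1)
    have b: "(K *v y) \<bullet> (K *v y) \<le> y \<bullet> y" using 4 by (simp add: norm_le)
    have "(norm (K *v x + c *\<^sub>R (E *v x)))\<^sup>2
        = x \<bullet> S + c / 2 * (S \<bullet> y) + c\<^sup>2 / 16 * ((K *v y) \<bullet> (K *v y))"
      unfolding E y_def[symmetric] power2_norm_eq_inner
      using 1 2 by (simp add: inner_add inner_commute power2_eq_square field_simps)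
    \<comment> \<open>Since \<open>x = y + S\<close>, the room
      \<open>x \<bullet> x - x \<bullet> S\<close> equals
      \<open>y \<bullet> y + S \<bullet> y\<close>, and \<open>a\<close> says that
      \<open>S \<bullet> y\<close> is nonnegative. The two perturbation terms therefore fit; any
      factor in (0, 1/2] in place of 1/4 would do.\<close>
    also have "\<dots> \<le> x \<bullet> x"
      using a b c inner_ge_zero[of y] unfolding xS by (auto simp: inner_add inner_commute simp del: inner_ge_zero)
    finally show ?thesis by (simp add: norm_eq_sqrt_inner real_le_rsqrt)
  qed
  from this[of 1] this[of "-1"] have "K + E \<in> contractions" "K - E \<in> contractions"
    by (auto simp: contractions_def matrix_vector_mult_add_rdistrib matrix_vector_mult_diff_rdistrib)
  then have "E = 0" using not_extreme_point_ofI assms by blast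
  then have "K *v (D *v x) = 0" for x using E[of x] by simp
  then have "D *v x = 0" for x
    using inj by (metis linear_injective_0[OF matrix_vector_mul_linear])
  then have "transpose K ** K = mat 1"
    by (simp add: D_def matrix_eq matrix_vector_mult_diff_rdistrib)
  then show ?thesis by (simp add: orthogonal_matrix)
qed

lemma contraction_in_hull_orthogonal:
  "(contractions :: (real^'q^'q) set) \<subseteq> convex hull {Q. orthogonal_matrix Q}"
proof -
  have "contractions = convex hull {x. x extreme_point_of (contractions :: (real^'q^'q) set)}"
    by (rule Krein_Milman_Minkowski[OF compact_contractions convex_contractions])
  also have "\<dots> \<subseteq> convex hull {Q. orthogonal_matrix Q}"
    by (intro hull_mono) (auto intro: extreme_contraction_orthogonal)
  finally show ?thesis .
qed

text \<open>Douglas' factorization lemma.\<close>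

lemma contraction_factor:
  fixes A B :: "real^'q^'d"
  assumes le: "\<And>v. norm (transpose A *v v) \<le> norm (transpose B *v v)"
  obtains K where "K \<in> contractions" "A = B ** K"
proof -
  let ?A = "transpose A" and ?B = "transpose B"
  let ?U = "range ((*v) ?B)"
  have sub: "subspace ?U" by (simp add: linear_subspace_image)
  obtain E where E: "E \<subseteq> ?U" "pairwise orthogonal E" "\<And>x. x \<in> E \<Longrightarrow> norm x = 1"
     "independent E" "span E = ?U"
    using orthonormal_basis_subspace[OF sub] by metis
  have finE: "finite E" using E(4) independent_imp_finite by blast
  have "\<forall>e\<in>E. \<exists>v. ?B *v v = e" using E(1) by auto
  then obtain g where g: "\<And>e. e \<in> E \<Longrightarrow> ?B *v g e = e" by metis
  \<comment> \<open>\<open>G\<close> lifts an orthonormal basis of the range of \<open>?B\<close>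
    through \<open>?B\<close>, so that \<open>?B\<close> after \<open>G\<close> is the orthogonal
    projection \<open>P\<close> onto this range. The factor sought is the transpose of
    \<open>N\<close>, the matrix of \<open>?A\<close> after \<open>G\<close>; it is a contraction
    because \<open>?A\<close> is dominated by \<open>?B\<close> and \<open>P\<close> shortens
    vectors.\<close>
  define G where "G x = (\<Sum>e\<in>E. (x \<bullet> e) *\<^sub>R g e)" for x
  have linG: "linear G"
    unfolding G_def by (rule linearI)
      (simp_all add: inner_add_left scaleR_left_distrib sum.distrib scaleR_sum_right)
  define P where "P x = ?B *v G x" for x
  have P: "P x = (\<Sum>e\<in>E. (x \<bullet> e) *\<^sub>R e)" for x
    unfolding P_def G_def using g
    by (simp add: linear_sum[OF matrix_vector_mul_linear] matrix_vector_mult_scaleR)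
  have ort: "(x - P x) \<bullet> e = 0" if "e \<in> E" for x e
  proof -
    have "P x \<bullet> e = (\<Sum>f\<in>E. (x \<bullet> f) * (f \<bullet> e))" by (simp add: P inner_sum_left)
    also have "\<dots> = (\<Sum>f\<in>E. if f = e then x \<bullet> e else 0)"
      using E(2,3) that by (intro sum.cong) (auto simp: pairwise_def orthogonal_def norm_eq_1)
    finally show ?thesis using that finE by (simp add: inner_diff_left)
  qed
  have ortU: "(x - P x) \<bullet> u = 0" if "u \<in> ?U" for x u
  proof -
    have "orthogonal (x - P x) u"
      by (rule orthogonal_to_span[of u E]) (use that E(5) ort in \<open>auto simp: orthogonal_def\<close>)
    then show ?thesis by (simp add: orthogonal_def)
  qed
  have PU: "P x \<in> ?U" for x by (simp add: P_def)
  have normP: "norm (P x) \<le> norm x" for x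
  proof -
    have "x \<bullet> x = P x \<bullet> P x + (x - P x) \<bullet> (x - P x)"
      using ortU[OF PU, of x x] by (simp add: inner_diff inner_commute)
    then have "P x \<bullet> P x \<le> x \<bullet> x" by simp
    then show ?thesis by (simp add: norm_le)
  qed
  have PB: "P (?B *v v) = ?B *v v" for v
  proof -
    have "?B *v v - P (?B *v v) \<in> ?U" using sub PU by (intro subspace_diff) auto
    from ortU[OF this] have "(?B *v v - P (?B *v v)) \<bullet> (?B *v v - P (?B *v v)) = 0" .
    then show ?thesis by simp
  qed
  define N where "N = matrix (\<lambda>x. ?A *v G x)"
  have "linear (\<lambda>x. ?A *v G x)"
    using linear_compose[OF linG matrix_vector_mul_linear[of ?A]] by (simp add: o_def)
  then have N: "N *v x = ?A *v G x" for x
    unfolding N_def by (simp add: matrix_works)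
  have "norm (N *v x) \<le> norm x" for x
    using le[of "G x"] normP[of x] by (simp add: N P_def)
  then have NC: "N \<in> contractions" by (simp add: contractions_def)
  have "?A *v v = (N ** ?B) *v v" for v
  proof -
    \<comment> \<open>A vector and the lift of its image differ by an element of the kernel of
      \<open>?B\<close>, which by \<open>le\<close> lies in the kernel of \<open>?A\<close>: the
      choice of the lift is invisible to \<open>?A\<close>.\<close>
    have "?B *v (v - G (?B *v v)) = 0"
      using PB[of v] by (simp add: P_def matrix_vector_mult_diff_distrib)
    then have "?A *v (v - G (?B *v v)) = 0" using le[of "v - G (?B *v v)"] by simp
    then show ?thesis
      by (simp add: N matrix_vector_mult_diff_distrib flip: matrix_vector_mul_assoc)
  qed
  then have "?A = N ** ?B" by (simp add: matrix_eq)
  then have "A = transpose (N ** ?B)" by (metis transpose_transpose)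
  then have AK: "A = B ** transpose N" by (simp add: matrix_transpose_mul)
  have "transpose N \<in> contractions"
    using norm_transpose_contraction[OF NC] by (simp add: contractions_def)
  with AK show ?thesis using that by blast
qed

text \<open>The quadratic form of \<open>C ** transpose C\<close> at \<open>v\<close> is the squared
  norm of \<open>transpose C *v v\<close>, and the symmetry demanded by \<open>pos_semidef\<close>
  is automatic. This is the form in which the factorization lemma takes its hypothesis.\<close>

lemma matrix_order_iff_norm:
  fixes A B :: "real^'q^'d"
  shows "A \<preceq>mat B \<longleftrightarrow> (\<forall>v. norm (transpose A *v v) \<le> norm (transpose B *v v))"
proof -
  have *: "v \<bullet> ((C ** transpose C) *v v) = (transpose C *v v) \<bullet> (transpose C *v v)"
    for C :: "real^'q^'d" and v
    by (metis inner_mult_transpose inner_commute matrix_vector_mul_assoc)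
  have "transpose (B ** transpose B - A ** transpose A) = B ** transpose B - A ** transpose A"
    by (simp add: vec_eq_iff transpose_def matrix_matrix_mult_def mult.commute)
  then show ?thesis
    by (simp add: matrix_order_def pos_semidef_def matrix_vector_mult_diff_rdistrib inner_diff_right
        * norm_le)
qed

lemma matrix_order_factor:
  assumes "A \<preceq>mat B" obtains K where "K \<in> contractions" "A = B ** K"
  using assms contraction_factor unfolding matrix_order_iff_norm by metis

lemma matrix_order_trans: "A \<preceq>mat B \<Longrightarrow> B \<preceq>mat C \<Longrightarrow> A \<preceq>mat C"
  unfolding matrix_order_iff_norm by (meson order_trans)

lemma matrix_order_scaleR: "A \<preceq>mat B \<Longrightarrow> c *\<^sub>R A \<preceq>mat c *\<^sub>R B"
  unfolding matrix_order_iff_norm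
  by (simp add: transpose_scalar scaleR_matrix_vector_assoc[symmetric] mult_left_mono)

section \<open>The standard normal distribution\<close>

text \<open>The double integral of \<open>1\<^sub>A(f x) 1\<^sub>B(y - f x)\<close>, with \<open>B\<close> the unit ball, is evaluated in
  both orders: this is the uniqueness argument for translation-invariant measures, the constant
  being fixed by \<open>B\<close>, which \<open>f\<close> leaves invariant.\<close>

lemma distr_lborel_orthogonal_transformation:
  fixes f :: "'a::euclidean_space \<Rightarrow> 'a"
  assumes f: "orthogonal_transformation f"
  shows "distr lborel borel f = lborel"
proof (rule measure_eqI)
  have lin: "linear f" and nf: "\<And>x. norm (f x) = norm x"
    using f by (auto simp: orthogonal_transformation)
  have [measurable]: "f \<in> borel_measurable borel"
    using lin by (simp add: borel_measurable_continuous_onI linear_continuous_on linear_conv_bounded_linear)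
  have surj: "surj f" using f orthogonal_transformation_surj by blast
  have shift: "(\<integral>\<^sup>+x. g (c + x) \<partial>lborel) = (\<integral>\<^sup>+x. g x \<partial>lborel)"
    if [measurable]: "g \<in> borel_measurable borel" for g :: "'a \<Rightarrow> ennreal" and c
    by (subst (2) lborel_distr_plus[of c, symmetric], subst nn_integral_distr) auto
  fix A assume "A \<in> sets (distr lborel borel f)"
  then have [measurable]: "A \<in> sets borel" by simp
  define B where "B = cball (0::'a) 1"
  have [measurable]: "B \<in> sets borel" by (simp add: B_def)
  have Bf: "indicator B (- f x) = (indicator B x :: ennreal)" for x
    by (simp add: B_def indicator_def nf)
  have "emeasure (distr lborel borel f) A * emeasure lborel B
      = (\<integral>\<^sup>+x. indicator A (f x) * (\<integral>\<^sup>+y. indicator B y \<partial>lborel) \<partial>lborel)"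
    by (subst nn_integral_multc) (auto simp flip: nn_integral_indicator simp: nn_integral_distr)
  also have "\<dots> = (\<integral>\<^sup>+x. (\<integral>\<^sup>+y. indicator A (f x) * indicator B (y - f x) \<partial>lborel) \<partial>lborel)"
    using shift[of "indicator B" "- f x" for x]
    by (simp add: nn_integral_cmult cong: nn_integral_cong)
  also have "\<dots> = (\<integral>\<^sup>+y. (\<integral>\<^sup>+x. indicator A (f x) * indicator B (y - f x) \<partial>lborel) \<partial>lborel)"
    by (rule lborel_pair.Fubini'[symmetric]) measurable
  also have "\<dots> = (\<integral>\<^sup>+y. (\<integral>\<^sup>+x. indicator A (y + f x) * indicator B (- f x) \<partial>lborel) \<partial>lborel)"
  proof (rule nn_integral_cong)
    fix y
    \<comment> \<open>Translating the inner variable by a preimage of \<open>y\<close> moves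
      \<open>y\<close> from the second factor to the first, because
      \<open>f (z + x) = y + f x\<close>.\<close>
    obtain z where z: "f z = y" using surj by (metis surjD)
    show "(\<integral>\<^sup>+x. indicator A (f x) * indicator B (y - f x) \<partial>lborel)
      = (\<integral>\<^sup>+x. indicator A (y + f x) * indicator B (- f x) \<partial>lborel)"
      using shift[of "\<lambda>x. indicator A (f x) * indicator B (y - f x)" z]
      by (simp add: linear_add[OF lin] z)
  qed
  also have "\<dots> = (\<integral>\<^sup>+x. (\<integral>\<^sup>+y. indicator A (y + f x) * indicator B (- f x) \<partial>lborel) \<partial>lborel)"
    by (rule lborel_pair.Fubini') measurable
  also have "\<dots> = (\<integral>\<^sup>+x. emeasure lborel A * indicator B x \<partial>lborel)"
    using shift[of "indicator A" "f x" for x]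
    by (simp add: nn_integral_multc Bf add.commute cong: nn_integral_cong)
  also have "\<dots> = emeasure lborel A * emeasure lborel B"
    by (simp add: nn_integral_cmult)
  finally have "emeasure (distr lborel borel f) A * emeasure lborel B = emeasure lborel A * emeasure lborel B" .
  moreover have "0 < emeasure lborel B"
    using unit_ball_vol_pos[of "real DIM('a)"]
    by (auto simp: B_def emeasure_cball zero_less_iff_neq_zero simp del: unit_ball_vol_pos)
  moreover have "emeasure lborel B < \<infinity>"
    unfolding B_def by (rule emeasure_lborel_cball_finite)
  ultimately show "emeasure (distr lborel borel f) A = emeasure lborel A"
    by (auto simp add: mult.commute[of _ "emeasure lborel B"] ennreal_mult_cancel_left)
qed simp

text \<open>The density is a function of the norm, which \<open>Q\<close> preserves, and the
  reference measure is invariant under \<open>Q\<close>.\<close>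

lemma distr_std_normal_vec_orthogonal:
  fixes Q :: "real^'q^'q"
  assumes "orthogonal_matrix Q"
  shows "distr std_normal_vec borel ((*v) Q) = std_normal_vec"
proof -
  have Q: "orthogonal_transformation ((*v) Q)"
    using assms by (simp add: orthogonal_transformation_matrix)
  have nQ: "norm (Q *v x) = norm x" for x using Q by (simp add: orthogonal_transformation)
  have [measurable]: "(*v) Q \<in> borel_measurable borel"
    by (simp add: borel_measurable_continuous_onI matrix_vector_mult_linear_continuous_on)
  let ?f = "\<lambda>z :: real^'q. ennreal (exp (- (norm z)\<^sup>2 / 2) / sqrt (2 * pi) ^ CARD('q))"
  have "density lborel ?f = density (distr lborel borel ((*v) Q)) ?f"
    by (simp add: distr_lborel_orthogonal_transformation[OF Q])
  also have "\<dots> = distr (density lborel (\<lambda>x. ?f (Q *v x))) borel ((*v) Q)"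
    by (rule density_distr) measurable
  finally show ?thesis by (simp add: std_normal_vec_def nQ)
qed

lemma sets_std_normal_vec [simp, measurable_cong]: "sets std_normal_vec = sets borel"
  by (simp add: std_normal_vec_def)

lemma space_std_normal_vec [simp]: "space std_normal_vec = UNIV"
  by (simp add: std_normal_vec_def)

text \<open>Half of the Gaussian exponent is spent on the power of the norm; the other half is again
  a Gaussian, dilated by \<open>sqrt 2\<close>.\<close>

lemma powr_le_exp_square:
  fixes p :: real
  assumes "p \<ge> 0"
  obtains C where "C > 0" "\<And>t. t \<ge> 0 \<Longrightarrow> t powr p \<le> C * exp (t\<^sup>2 / 4)"
proof -
  obtain n :: nat where n: "p \<le> real n" using real_arch_simple by blast
  then have n: "p \<le> real (2 * n)" by simp
  show ?thesis
  \<comment> \<open>The summand 1 covers \<open>t \<le> 1\<close>; the factor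
    \<open>4 ^ n * fact n\<close> turns \<open>t ^ (2 * n)\<close> into the \<open>n\<close>-th term
    of the series of \<open>exp (t\<^sup>2 / 4)\<close>.\<close>
  proof (rule that[of "1 + 4 ^ n * fact n"])
    show "(0::real) < 1 + 4 ^ n * fact n" by (simp add: add_pos_pos)
    fix t :: real assume t: "t \<ge> 0"
    have "t powr p \<le> 1 + t ^ (2 * n)"
    proof (cases "t \<le> 1")
      case True
      then have "t powr p \<le> 1" using t assms by (simp add: powr_le1)
      then show ?thesis using t by (simp add: add_increasing2)
    next
      case False
      then have "t powr p \<le> t powr real (2 * n)" using n by (intro powr_mono) auto
      then show ?thesis using False by (simp add: powr_realpow del: of_nat_mult)
    qed
    also have "t ^ (2 * n) = (4 ^ n * fact n) * ((t\<^sup>2 / 4) ^ n / fact n)"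
      by (simp add: power_mult power_divide del: fact_Suc)
    also have "(t\<^sup>2 / 4) ^ n / fact n \<le> exp (t\<^sup>2 / 4)"
    proof -
      have single: "sum g {n} = g n" for g :: "nat \<Rightarrow> real" by simp
      have "sum (\<lambda>k. (t\<^sup>2 / 4) ^ k /\<^sub>R fact k) {n} \<le> exp (t\<^sup>2 / 4)"
        unfolding exp_def by (rule sum_le_suminf[OF summable_exp_generic]) auto
      moreover have "sum (\<lambda>k. (t\<^sup>2 / 4) ^ k /\<^sub>R fact k) {n} = (t\<^sup>2 / 4) ^ n / fact n"
        using single[of "\<lambda>k. (t\<^sup>2 / 4) ^ k /\<^sub>R fact k"] by (simp only: real_scaleR_def divide_inverse mult.commute)
      ultimately show ?thesis by (simp only:)
    qed
    finally have "t powr p \<le> 1 + 4 ^ n * fact n * exp (t\<^sup>2 / 4)" by simp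
    also have "1 \<le> exp (t\<^sup>2 / 4)" by simp
    finally show "t powr p \<le> (1 + 4 ^ n * fact n) * exp (t\<^sup>2 / 4)" by (simp add: distrib_right)
  qed
qed

text \<open>Total mass 1 is a hypothesis here, to be discharged by the fact that the measure is the
  law of a random variable. The moment is then bounded by a multiple of that mass, after absorbing
  the power into half of the exponent and rescaling.\<close>

lemma integrable_norm_powr_std_normal_vec:
  assumes "prob_space (std_normal_vec :: (real^'q) measure)" "p \<ge> 0"
  shows "integrable (std_normal_vec :: (real^'q) measure) (\<lambda>z. norm z powr p)"
proof -
  obtain C where C: "C > 0" "\<And>t. t \<ge> 0 \<Longrightarrow> t powr p \<le> C * exp (t\<^sup>2 / 4)"
    using powr_le_exp_square[OF assms(2)] by metis
  let ?c = "sqrt (2 * pi) ^ CARD('q)"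
  let ?f = "\<lambda>z :: real^'q. exp (- (norm z)\<^sup>2 / 2) / ?c"
  have c: "?c > 0" by simp
  have tot: "(\<integral>\<^sup>+z. ?f z \<partial>lborel) = 1"
    using prob_space.emeasure_space_1[OF assms(1)]
    by (simp add: std_normal_vec_def emeasure_density)
  have "(\<integral>\<^sup>+z. ennreal (norm z powr p) \<partial>(std_normal_vec :: (real^'q) measure))
      = (\<integral>\<^sup>+z. ennreal (?f z * norm z powr p) \<partial>lborel)"
    unfolding std_normal_vec_def by (subst nn_integral_density) (auto intro!: nn_integral_cong simp flip: ennreal_mult')
  also have "\<dots> \<le> (\<integral>\<^sup>+z. ennreal (C * ?f ((1 / sqrt 2) *\<^sub>R z)) \<partial>(lborel :: (real^'q) measure))"
  proof (intro nn_integral_mono ennreal_leI)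
    fix z :: "real^'q"
    have "exp (- (norm z)\<^sup>2 / 2) * norm z powr p \<le> exp (- (norm z)\<^sup>2 / 2) * (C * exp ((norm z)\<^sup>2 / 4))"
      using C(2)[of "norm z"] by (intro mult_left_mono) auto
    also have "\<dots> = C * exp (- (norm ((1 / sqrt 2) *\<^sub>R z))\<^sup>2 / 2)"
      by (simp add: power_divide flip: exp_add)
    finally show "?f z * norm z powr p \<le> C * ?f ((1 / sqrt 2) *\<^sub>R z)"
      using c by (simp add: divide_simps)
  qed
  also have "\<dots> = ennreal C * (\<integral>\<^sup>+z. ennreal (?f ((1 / sqrt 2) *\<^sub>R z)) \<partial>lborel)"
    using C(1) by (subst nn_integral_cmult[symmetric]) (auto intro!: nn_integral_cong simp flip: ennreal_mult')
  \<comment> \<open>The substitution by the dilation with factor \<open>sqrt 2\<close> restores the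
    original density and costs the Jacobian.\<close>
  also have "(\<integral>\<^sup>+z. ennreal (?f ((1 / sqrt 2) *\<^sub>R z)) \<partial>lborel)
      = ennreal (\<bar>sqrt 2\<bar> ^ DIM(real^'q)) * (\<integral>\<^sup>+z. ?f z \<partial>lborel)"
    by (subst lborel_affine[of "sqrt 2" 0], simp, subst nn_integral_density, simp, simp,
        subst nn_integral_distr, simp, simp)
      (simp add: nn_integral_cmult)
  finally have "(\<integral>\<^sup>+z. ennreal (norm z powr p) \<partial>(std_normal_vec :: (real^'q) measure)) < \<infinity>"
    unfolding tot by (simp add: ennreal_mult_less_top order_le_less_trans)
  then show ?thesis
    by (intro integrableI_bounded) auto
qed

section \<open>Gaussian integrals of convex functions\<close>

lemma norm_mult_op_norm: "norm (A *v z) \<le> op_norm A * norm z"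
  unfolding op_norm_def by (rule onorm) (simp add: linear_conv_bounded_linear[symmetric])

lemma op_norm_nonneg [simp]: "0 \<le> op_norm A"
  unfolding op_norm_def by (rule onorm_pos_le) (simp add: linear_conv_bounded_linear[symmetric])

lemma powr_add_le:
  fixes a b p :: real
  assumes "0 \<le> a" "0 \<le> b" "0 \<le> p"
  shows "(a + b) powr p \<le> 2 powr p * (a powr p + b powr p)"
proof -
  have "(a + b) powr p \<le> (2 * max a b) powr p"
    using assms by (intro powr_mono2) auto
  also have "\<dots> = 2 powr p * max a b powr p"
    using assms by (simp add: powr_mult)
  also have "max a b powr p \<le> a powr p + b powr p"
    by (simp add: max_def)
  finally show ?thesis by simp
qed

lemma borel_measurable_convex:
  fixes \<psi> :: "'a::euclidean_space \<Rightarrow> real"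
  assumes "convex_on UNIV \<psi>" shows "\<psi> \<in> borel_measurable borel"
  using convex_on_continuous[OF open_UNIV assms] by (rule borel_measurable_continuous_onI)

lemma borel_measurable_matrix_vector_mult [measurable]:
  "(*v) (A :: real^'q^'d) \<in> borel_measurable borel"
  by (simp add: borel_measurable_continuous_onI matrix_vector_mult_linear_continuous_on)

lemma integrable_convex_gaussian:
  fixes \<psi> :: "real^'d \<Rightarrow> real" and A :: "real^'q^'d"
  assumes N: "prob_space (std_normal_vec :: (real^'q) measure)" and p: "0 \<le> p"
    and \<psi>: "convex_on UNIV \<psi>" and bound: "\<And>w. \<bar>\<psi> w\<bar> \<le> c * (1 + norm w powr p)"
  shows "integrable std_normal_vec (\<lambda>z. \<psi> (a + A *v z))"
proof -
  interpret prob_space "std_normal_vec :: (real^'q) measure" by (rule N)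
  note borel_measurable_convex[OF \<psi>, measurable]
  have c: "0 \<le> c" using bound[of 0] abs_ge_zero[of "\<psi> 0"] by (simp split: if_splits)
  show ?thesis
  proof (rule Bochner_Integration.integrable_bound)
    show "integrable std_normal_vec
        (\<lambda>z :: real^'q. c * (1 + 2 powr p * (norm a powr p + op_norm A powr p * norm z powr p)))"
      using integrable_norm_powr_std_normal_vec[OF N p]
      by (intro integrable_mult_right Bochner_Integration.integrable_add integrable_const)
    show "AE z in std_normal_vec. norm (\<psi> (a + A *v z))
       \<le> norm (c * (1 + 2 powr p * (norm a powr p + op_norm A powr p * norm (z :: real^'q) powr p)))"
    proof (intro AE_I2)
      fix z :: "real^'q"
      have "norm (a + A *v z) powr p \<le> (norm a + op_norm A * norm z) powr p"
        using norm_triangle_ineq[of a "A *v z"] norm_mult_op_norm[of A z] p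
        by (intro powr_mono2) auto
      also have "\<dots> \<le> 2 powr p * (norm a powr p + (op_norm A * norm z) powr p)"
        using p by (intro powr_add_le) auto
      finally have "c * (1 + norm (a + A *v z) powr p)
          \<le> c * (1 + 2 powr p * (norm a powr p + op_norm A powr p * norm z powr p))"
        using c by (intro mult_left_mono) (auto simp: powr_mult)
      with bound[of "a + A *v z"]
      show "norm (\<psi> (a + A *v z)) \<le> norm (c * (1 + 2 powr p * (norm a powr p + op_norm A powr p * norm z powr p)))"
        unfolding real_norm_def by (rule order_trans[OF order_trans abs_ge_self])
    qed
  qed measurable
qed

text \<open>Since \<open>A = B K\<close> with a contraction \<open>K\<close>, and \<open>K \<mapsto> \<integral>\<psi>(a + B K z) dN(z)\<close> is convex with the same
  value at all orthogonal matrices, the claim follows from the hull representation of contractions.\<close>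

lemma gaussian_convex_mono:
  fixes \<psi> :: "real^'d \<Rightarrow> real" and A B :: "real^'q^'d"
  assumes N: "prob_space (std_normal_vec :: (real^'q) measure)" and p: "0 \<le> p"
    and \<psi>: "convex_on UNIV \<psi>" and bound: "\<And>w. \<bar>\<psi> w\<bar> \<le> c * (1 + norm w powr p)"
    and AB: "A \<preceq>mat B"
  shows "(\<integral>z. \<psi> (a + A *v z) \<partial>std_normal_vec) \<le> (\<integral>z. \<psi> (a + B *v z) \<partial>std_normal_vec)"
proof -
  note borel_measurable_convex[OF \<psi>, measurable]
  note int = integrable_convex_gaussian[OF N p \<psi> bound]
  obtain K where K: "K \<in> contractions" "A = B ** K" using matrix_order_factor[OF AB] .
  define f where "f K = (\<integral>z. \<psi> (a + (B ** K) *v z) \<partial>std_normal_vec)" for K :: "real^'q^'q"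
  have "convex_on UNIV f"
  proof (rule convex_onI)
    fix t :: real and x y :: "real^'q^'q"
    assume t: "0 < t" "t < 1"
    have "f ((1 - t) *\<^sub>R x + t *\<^sub>R y)
      \<le> (\<integral>z. (1 - t) * \<psi> (a + (B ** x) *v z) + t * \<psi> (a + (B ** y) *v z) \<partial>std_normal_vec)"
      unfolding f_def
    proof (rule integral_mono)
      fix z :: "real^'q"
      have "a + (B ** ((1 - t) *\<^sub>R x + t *\<^sub>R y)) *v z
         = (1 - t) *\<^sub>R (a + (B ** x) *v z) + t *\<^sub>R (a + (B ** y) *v z)"
        by (simp add: matrix_vector_mult_add_rdistrib matrix_vector_right_distrib matrix_vector_mult_scaleR
            scaleR_right_distrib flip: matrix_vector_mul_assoc scaleR_matrix_vector_assoc)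
      then show "\<psi> (a + (B ** ((1 - t) *\<^sub>R x + t *\<^sub>R y)) *v z)
          \<le> (1 - t) * \<psi> (a + (B ** x) *v z) + t * \<psi> (a + (B ** y) *v z)"
        using convex_onD[OF \<psi>, of t] t by simp
    qed (use int in auto)
    then show "f ((1 - t) *\<^sub>R x + t *\<^sub>R y) \<le> (1 - t) * f x + t * f y"
      using int by (simp add: f_def)
  qed simp
  moreover have "f Q = (\<integral>z. \<psi> (a + B *v z) \<partial>std_normal_vec)" if "orthogonal_matrix Q" for Q
  proof -
    have "(\<integral>z. \<psi> (a + B *v z) \<partial>std_normal_vec) = (\<integral>z. \<psi> (a + B *v z) \<partial>(distr std_normal_vec borel ((*v) Q)))"
      by (simp add: distr_std_normal_vec_orthogonal[OF that])
    also have "\<dots> = f Q"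
      unfolding f_def by (subst integral_distr) (simp_all add: matrix_vector_mul_assoc)
    finally show ?thesis by simp
  qed
  ultimately have "\<forall>x \<in> convex hull {Q. orthogonal_matrix Q}. f x \<le> (\<integral>z. \<psi> (a + B *v z) \<partial>std_normal_vec)"
    using convex_on_convex_hull_bound[of "{Q. orthogonal_matrix Q}" f]
      convex_on_subset[of UNIV f "convex hull {Q. orthogonal_matrix Q}"] by simp
  then show ?thesis
    using K contraction_in_hull_orthogonal by (auto simp: f_def)
qed

section \<open>Convex functionals of paths\<close>

text \<open>Paths are total functions here, so that a step is a function update and the product
  topology is available; the first clause makes the coordinates beyond \<open>m\<close> irrelevant.
  A sum of powers replaces the maximum in the growth bound because it integrates term by
  term.\<close>

definition path_functional :: "nat \<Rightarrow> real \<Rightarrow> ((nat \<Rightarrow> 'a::real_normed_vector) \<Rightarrow> real) \<Rightarrow> bool" where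
  "path_functional m p F \<longleftrightarrow>
     (\<forall>x y. (\<forall>i\<le>m. x i = y i) \<longrightarrow> F x = F y) \<and>
     (\<forall>x y. \<forall>u\<in>{0..1}. F (\<lambda>i. u *\<^sub>R x i + (1 - u) *\<^sub>R y i) \<le> u * F x + (1 - u) * F y) \<and>
     (\<exists>C\<ge>0. \<forall>x. \<bar>F x\<bar> \<le> C * (1 + (\<Sum>i\<le>m. norm (x i) powr p)))"

lemma path_functional_cong:
  "path_functional m p F \<Longrightarrow> (\<And>i. i \<le> m \<Longrightarrow> x i = y i) \<Longrightarrow> F x = F y"
  by (auto simp: path_functional_def)

lemma path_functional_convex:
  "path_functional m p F \<Longrightarrow> 0 \<le> u \<Longrightarrow> u \<le> 1 \<Longrightarrow>
     F (\<lambda>i. u *\<^sub>R x i + (1 - u) *\<^sub>R y i) \<le> u * F x + (1 - u) * F y"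
  by (auto simp: path_functional_def)

lemma path_functional_growth:
  assumes "path_functional m p F"
  obtains C where "C \<ge> 0" "\<And>x. \<bar>F x\<bar> \<le> C * (1 + (\<Sum>i\<le>m. norm (x i) powr p))"
  using assms by (auto simp: path_functional_def)

text \<open>This serves measurability. Paths carry the product topology and no norm, so the
  classical proof that a locally bounded convex function is continuous is run with the seminorm
  \<open>r\<close>, the sum of the distances of the relevant coordinates.\<close>

lemma isCont_path_functional:
  fixes F :: "(nat \<Rightarrow> 'a::real_normed_vector) \<Rightarrow> real"
  assumes F: "path_functional m p F" and p: "0 \<le> p"
  shows "isCont F x"
proof -
  obtain C where C: "C \<ge> 0" "\<And>x. \<bar>F x\<bar> \<le> C * (1 + (\<Sum>i\<le>m. norm (x i) powr p))"
    using path_functional_growth[OF F] by blast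
  define K where "K = C * (1 + (\<Sum>i\<le>m. (norm (x i) + 1) powr p))"
  have K: "F z \<le> K" if "\<And>i. i \<le> m \<Longrightarrow> norm (z i - x i) \<le> 1" for z
  proof -
    have "norm (z i) \<le> norm (x i) + 1" if "i \<le> m" for i
      using \<open>\<And>i. i \<le> m \<Longrightarrow> norm (z i - x i) \<le> 1\<close>[OF that] norm_triangle_ineq2[of "z i" "x i"] by linarith
    then have "(\<Sum>i\<le>m. norm (z i) powr p) \<le> (\<Sum>i\<le>m. (norm (x i) + 1) powr p)"
      using p by (intro sum_mono powr_mono2) auto
    then have "C * (1 + (\<Sum>i\<le>m. norm (z i) powr p)) \<le> K"
      unfolding K_def using C(1) by (intro mult_left_mono) auto
    then show ?thesis using C(2)[of z] by linarith
  qed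
  define r where "r y = (\<Sum>i\<le>m. norm (y i - x i))" for y :: "nat \<Rightarrow> 'a"
  have bound: "\<bar>F y - F x\<bar> \<le> r y * (K + \<bar>F x\<bar>)" if r1: "r y < 1" for y
  proof (cases "r y = 0")
    case True
    then have "\<forall>i\<le>m. y i = x i" by (simp add: r_def sum_nonneg_eq_0_iff)
    then have "F y = F x" using F path_functional_cong by metis
    then show ?thesis using True by simp
  next
    case False
    define s where "s = r y"
    have s: "0 < s" "s < 1"
      using False r1 by (auto simp: s_def r_def order_less_le sum_nonneg)
    have le: "norm (y i - x i) \<le> s" if "i \<le> m" for i
      unfolding s_def r_def using that by (intro member_le_sum[of i "{..m}"]) auto
    \<comment> \<open>\<open>z\<close> lies beyond \<open>y\<close> on the ray from
      \<open>x\<close>, and \<open>w\<close> is its mirror image in \<open>x\<close>; dividing by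
      \<open>s\<close> keeps every relevant coordinate within distance 1 of \<open>x\<close>.
      Convexity on the segment from \<open>x\<close> to \<open>z\<close> bounds \<open>F y\<close>
      from above, and on the segment from \<open>w\<close> to \<open>y\<close> from below.\<close>
    define z where "z i = x i + (1 / s) *\<^sub>R (y i - x i)" for i
    define w where "w i = x i - (1 / s) *\<^sub>R (y i - x i)" for i
    have Fz: "F z \<le> K" "F w \<le> K"
      using le s by (auto intro!: K simp: z_def w_def divide_simps)
    have "y = (\<lambda>i. s *\<^sub>R z i + (1 - s) *\<^sub>R x i)"
      using s by (auto simp: z_def algebra_simps)
    then have "F y \<le> s * F z + (1 - s) * F x"
      using path_functional_convex[OF F, of s z x] s by simp
    moreover have "s * F z \<le> s * K" using Fz s by simp
    moreover have "s * (- F x) \<le> s * \<bar>F x\<bar>" using s by (intro mult_left_mono) auto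
    ultimately have 1: "F y - F x \<le> s * (K + \<bar>F x\<bar>)" by (simp add: algebra_simps)
    define u where "u = 1 / (1 + s)"
    have u: "0 \<le> u" "u \<le> 1" "(1 + s) * u = 1" "1 - u = u * s" using s by (auto simp: u_def field_simps)
    have "x i = u *\<^sub>R y i + (1 - u) *\<^sub>R w i" for i
    proof -
      have "u *\<^sub>R y i + (1 - u) *\<^sub>R w i = ((1 + s) * u) *\<^sub>R x i"
        using s unfolding u(4) w_def by (simp add: algebra_simps)
      then show ?thesis using u(3) by simp
    qed
    then have "x = (\<lambda>i. u *\<^sub>R y i + (1 - u) *\<^sub>R w i)" by (rule ext)
    then have "F x \<le> u * F y + (1 - u) * F w"
      using path_functional_convex[OF F u(1,2), of y w] by simp
    also have "\<dots> = u * (F y + s * F w)" by (simp only: u(4) distrib_left mult.assoc)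
    finally have "(1 + s) * F x \<le> (1 + s) * (u * (F y + s * F w))"
      using s by (intro mult_left_mono) auto
    also have "\<dots> = F y + s * F w" using u(3) by (metis mult.assoc mult_1)
    finally have "F x - F y \<le> s * F w - s * F x" by (simp add: algebra_simps)
    also have "\<dots> \<le> s * (K + \<bar>F x\<bar>)"
    proof -
      have "s * F w \<le> s * K" using Fz s by simp
      moreover have "s * (- F x) \<le> s * \<bar>F x\<bar>" using s by (intro mult_left_mono) auto
      ultimately show ?thesis by (simp add: algebra_simps)
    qed
    finally have 2: "F x - F y \<le> s * (K + \<bar>F x\<bar>)" .
    from 1 2 show ?thesis by (simp add: s_def abs_if)
  qed
  have "isCont (\<lambda>y :: nat \<Rightarrow> 'a. y i) x" for i
    by (rule continuous_on_interior[OF continuous_on_product_coordinates]) simp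
  then have "isCont r x" unfolding r_def by (intro continuous_intros)
  moreover have "r x = 0" by (simp add: r_def)
  ultimately have r0: "(r \<longlongrightarrow> 0) (at x)" by (simp add: isCont_def)
  then have "eventually (\<lambda>y. r y < 1) (at x)" by (rule order_tendstoD) simp
  then have "eventually (\<lambda>y. norm (F y - F x) \<le> r y * (K + \<bar>F x\<bar>)) (at x)"
    by eventually_elim (simp add: bound)
  moreover have "((\<lambda>y. r y * (K + \<bar>F x\<bar>)) \<longlongrightarrow> 0) (at x)"
    using tendsto_mult_left_zero[OF r0] .
  ultimately have "((\<lambda>y. F y - F x) \<longlongrightarrow> 0) (at x)"
    by (rule tendsto_norm_zero_cancel[OF tendsto_sandwich[OF _ _ tendsto_const], rotated]) auto
  then show ?thesis by (simp add: isCont_def LIM_zero_iff)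
qed

text \<open>Nothing is known about the coordinates beyond \<open>m\<close>, so they are set to 0,
  which does not change the value of \<open>F\<close>.\<close>

lemma borel_measurable_path_functional:
  fixes F :: "(nat \<Rightarrow> 'a::euclidean_space) \<Rightarrow> real"
  assumes F: "path_functional m p F" and p: "0 \<le> p"
    and X: "\<And>i. i \<le> m \<Longrightarrow> (\<lambda>\<omega>. X \<omega> i) \<in> borel_measurable M"
  shows "(\<lambda>\<omega>. F (X \<omega>)) \<in> borel_measurable M"
proof -
  have [measurable]: "F \<in> borel_measurable borel"
    using isCont_path_functional[OF F p]
    by (intro borel_measurable_continuous_onI) (simp add: continuous_on_eq_continuous_at)
  have [measurable]: "(\<lambda>\<omega> i. if i \<le> m then X \<omega> i else 0) \<in> borel_measurable M"
  proof (rule measurable_coordinatewise_then_product)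
    show "(\<lambda>\<omega>. if i \<le> m then X \<omega> i else 0) \<in> borel_measurable M" for i
      using X by (cases "i \<le> m") auto
  qed
  have "(\<lambda>\<omega>. F (X \<omega>)) = (\<lambda>\<omega>. F (\<lambda>i. if i \<le> m then X \<omega> i else 0))"
    by (intro ext path_functional_cong[OF F]) simp
  then show ?thesis by simp
qed

lemma integrable_path_functional:
  fixes F :: "(nat \<Rightarrow> 'a::euclidean_space) \<Rightarrow> real"
  assumes F: "path_functional m p F" and p: "0 \<le> p" and M: "finite_measure M"
    and X: "\<And>i. i \<le> m \<Longrightarrow> (\<lambda>\<omega>. X \<omega> i) \<in> borel_measurable M"
    and int: "\<And>i. i \<le> m \<Longrightarrow> integrable M (\<lambda>\<omega>. norm (X \<omega> i) powr p)"
  shows "integrable M (\<lambda>\<omega>. F (X \<omega>))"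
proof -
  interpret finite_measure M by (rule M)
  obtain C where C: "C \<ge> 0" "\<And>x. \<bar>F x\<bar> \<le> C * (1 + (\<Sum>i\<le>m. norm (x i) powr p))"
    using path_functional_growth[OF F] by blast
  show ?thesis
  proof (rule Bochner_Integration.integrable_bound)
    show "integrable M (\<lambda>\<omega>. C * (1 + (\<Sum>i\<le>m. norm (X \<omega> i) powr p)))"
      using int by (intro integrable_mult_right Bochner_Integration.integrable_add integrable_const
          Bochner_Integration.integrable_sum) auto
    show "(\<lambda>\<omega>. F (X \<omega>)) \<in> borel_measurable M"
      using borel_measurable_path_functional[OF F p X] .
    show "AE \<omega> in M. norm (F (X \<omega>)) \<le> norm (C * (1 + (\<Sum>i\<le>m. norm (X \<omega> i) powr p)))"
      using C(2) by (intro AE_I2) (simp only: real_norm_def order_trans[OF _ abs_ge_self])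
  qed
qed

text \<open>Time and law are already substituted in \<open>\<beta>\<close> and \<open>S\<close>;
  with them frozen, the step is an ordinary Markov kernel acting on functionals.\<close>

definition gauss_step ::
    "nat \<Rightarrow> (real^'d \<Rightarrow> real^'d) \<Rightarrow> (real^'d \<Rightarrow> real^'q^'d) \<Rightarrow> ((nat \<Rightarrow> real^'d) \<Rightarrow> real) \<Rightarrow> (nat \<Rightarrow> real^'d) \<Rightarrow> real"
  where "gauss_step m \<beta> S F x = (\<integral>z. F (x(Suc m := \<beta> (x m) + S (x m) *v z)) \<partial>std_normal_vec)"

text \<open>With the coordinates up to \<open>m\<close> frozen, their contribution to the growth
  becomes part of the constant, and the Gaussian comparison applies to the last coordinate
  alone.\<close>

lemma path_functional_section:
  fixes F :: "(nat \<Rightarrow> 'a::real_normed_vector) \<Rightarrow> real"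
  assumes F: "path_functional (Suc m) p F"
  shows "convex_on UNIV (\<lambda>w. F (x(Suc m := w)))"
    and "\<exists>c. \<forall>w. \<bar>F (x(Suc m := w))\<bar> \<le> c * (1 + norm w powr p)"
proof -
  show "convex_on UNIV (\<lambda>w. F (x(Suc m := w)))"
  proof (rule convex_onI)
    fix t :: real and v w :: 'a assume t: "0 < t" "t < 1"
    have "x(Suc m := (1 - t) *\<^sub>R v + t *\<^sub>R w)
      = (\<lambda>i. (1 - t) *\<^sub>R (x(Suc m := v)) i + (1 - (1 - t)) *\<^sub>R (x(Suc m := w)) i)"
      by (auto simp flip: scaleR_left_distrib)
    then show "F (x(Suc m := (1 - t) *\<^sub>R v + t *\<^sub>R w)) \<le> (1 - t) * F (x(Suc m := v)) + t * F (x(Suc m := w))"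
      using path_functional_convex[OF F, of "1 - t" "x(Suc m := v)" "x(Suc m := w)"] t by simp
  qed simp
  obtain C where C: "C \<ge> 0" "\<And>x. \<bar>F x\<bar> \<le> C * (1 + (\<Sum>i\<le>Suc m. norm (x i) powr p))"
    using path_functional_growth[OF F] by blast
  define s where "s = (\<Sum>i\<le>m. norm (x i) powr p)"
  have s: "0 \<le> s" by (simp add: s_def sum_nonneg)
  show "\<exists>c. \<forall>w. \<bar>F (x(Suc m := w))\<bar> \<le> c * (1 + norm w powr p)"
  proof (intro exI allI)
    fix w
    have "(\<Sum>i\<le>Suc m. norm ((x(Suc m := w)) i) powr p) = s + norm w powr p"
      by (simp add: s_def)
    then have "\<bar>F (x(Suc m := w))\<bar> \<le> C * (1 + (s + norm w powr p))"
      using C(2)[of "x(Suc m := w)"] by simp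
    also have "\<dots> \<le> C * ((1 + s) * (1 + norm w powr p))"
      using C(1) s by (intro mult_left_mono) (auto simp: algebra_simps)
    finally show "\<bar>F (x(Suc m := w))\<bar> \<le> C * (1 + s) * (1 + norm w powr p)"
      by (simp add: mult.assoc)
  qed
qed

lemma integrable_gauss_step:
  fixes S :: "real^'d \<Rightarrow> real^'q^'d"
  assumes "prob_space (std_normal_vec :: (real^'q) measure)" "0 \<le> p" "path_functional (Suc m) p F"
  shows "integrable std_normal_vec (\<lambda>z :: real^'q. F (x(Suc m := a + A *v z)))"
  using path_functional_section[OF assms(3), of x] integrable_convex_gaussian[OF assms(1,2)]
  by blast

lemma gauss_step_mono:
  fixes S S' :: "real^'d \<Rightarrow> real^'q^'d"
  assumes "prob_space (std_normal_vec :: (real^'q) measure)" "0 \<le> p" "path_functional (Suc m) p F"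
    and "S (x m) \<preceq>mat S' (x m)"
  shows "gauss_step m \<beta> S F x \<le> gauss_step m \<beta> S' F x"
  unfolding gauss_step_def
  using path_functional_section[OF assms(3), of x] gaussian_convex_mono[OF assms(1,2) _ _ assms(4)]
  by blast

definition linear_growth :: "('a::real_normed_vector \<Rightarrow> 'b) \<Rightarrow> ('b \<Rightarrow> real) \<Rightarrow> bool" where
  "linear_growth f N \<longleftrightarrow> (\<exists>c\<ge>0. \<forall>x. N (f x) \<le> c * (1 + norm x))"

text \<open>The bound is a product of a function of the state and a function of the noise, so that
  independence lets the two be integrated separately.\<close>

lemma affine_step_powr_bound:
  fixes \<beta> :: "real^'d \<Rightarrow> real^'d" and S :: "real^'d \<Rightarrow> real^'q^'d"
  assumes "linear_growth \<beta> norm" "linear_growth S op_norm" "0 \<le> p"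
  obtains c where "c \<ge> 0" "\<And>x z. norm (\<beta> x + S x *v z) powr p \<le> c * ((1 + norm x powr p) * (1 + norm z powr p))"
proof -
  obtain a b where a: "0 \<le> a" "\<And>x. norm (\<beta> x) \<le> a * (1 + norm x)"
    and b: "0 \<le> b" "\<And>x. op_norm (S x) \<le> b * (1 + norm x)"
    using assms by (auto simp: linear_growth_def)
  show ?thesis
  proof (rule that[of "(a + b) powr p * (2 powr p * 2 powr p)"])
    fix x z
    have "norm (\<beta> x + S x *v z) \<le> norm (\<beta> x) + op_norm (S x) * norm z"
      by (intro order_trans[OF norm_triangle_ineq] add_left_mono norm_mult_op_norm)
    also have "\<dots> \<le> a * (1 + norm x) + b * (1 + norm x) * norm z"
      using a b by (intro add_mono mult_right_mono) auto
    also have "\<dots> \<le> a * (1 + norm x) * (1 + norm z) + b * (1 + norm x) * (1 + norm z)"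
      using mult_right_mono[of 1 "1 + norm z" "a * (1 + norm x)"] a(1) b(1)
      by (intro add_mono mult_left_mono) (auto simp: mult.commute)
    also have "\<dots> = (a + b) * ((1 + norm x) * (1 + norm z))"
      by (simp add: algebra_simps)
    finally have "norm (\<beta> x + S x *v z) powr p \<le> ((a + b) * ((1 + norm x) * (1 + norm z))) powr p"
      using assms(3) by (intro powr_mono2) auto
    also have "\<dots> = (a + b) powr p * ((1 + norm x) powr p * (1 + norm z) powr p)"
      using a b by (simp add: powr_mult)
    also have "\<dots> \<le> (a + b) powr p * ((2 powr p * (1 powr p + norm x powr p)) * (2 powr p * (1 powr p + norm z powr p)))"
      using assms(3) by (intro mult_left_mono mult_mono powr_add_le) auto
    finally show "norm (\<beta> x + S x *v z) powr p
      \<le> (a + b) powr p * (2 powr p * 2 powr p) * ((1 + norm x powr p) * (1 + norm z powr p))"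
      by (simp add: mult_ac)
  qed simp
qed

lemma path_functional_gauss_step:
  fixes \<beta> :: "real^'d \<Rightarrow> real^'d" and S :: "real^'d \<Rightarrow> real^'q^'d"
  assumes N: "prob_space (std_normal_vec :: (real^'q) measure)" and p: "0 \<le> p"
    and F: "path_functional (Suc m) p F" and \<beta>: "affine_fun \<beta>"
    and growth: "linear_growth \<beta> norm" "linear_growth S op_norm"
    and S: "\<And>x y u. u \<in> {0..1} \<Longrightarrow> S (u *\<^sub>R x + (1 - u) *\<^sub>R y) \<preceq>mat u *\<^sub>R S x + (1 - u) *\<^sub>R S y"
  shows "path_functional m p (gauss_step m \<beta> S F)"
  unfolding path_functional_def
proof (intro conjI allI impI ballI)
  interpret prob_space "std_normal_vec :: (real^'q) measure" by (rule N)
  note int = integrable_gauss_step[OF N p F]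
  fix x y :: "nat \<Rightarrow> real^'d"
  show "gauss_step m \<beta> S F x = gauss_step m \<beta> S F y" if "\<forall>i\<le>m. x i = y i"
  proof -
    have "F (x(Suc m := w)) = F (y(Suc m := w))" for w
      using that by (intro path_functional_cong[OF F]) (auto simp: le_Suc_eq)
    then show ?thesis using that by (simp add: gauss_step_def)
  qed
  fix u :: real assume u: "u \<in> {0..1}"
  let ?w = "\<lambda>i. u *\<^sub>R x i + (1 - u) *\<^sub>R y i"
  \<comment> \<open>An equality is essential: \<open>F\<close> is not monotone, so a bound on the
    drift would say nothing about the values of \<open>F\<close>.\<close>
  have \<beta>w: "\<beta> (?w m) = u *\<^sub>R \<beta> (x m) + (1 - u) *\<^sub>R \<beta> (y m)"
    using \<beta> by (auto simp: affine_fun_def linear_add linear_scale) (simp add: algebra_simps)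
  \<comment> \<open>The diffusion matrix at the mixed state is replaced by the mixture of the
    matrices, as a constant map because \<open>gauss_step\<close> evaluates it at
    \<open>?w m\<close> only.\<close>
  have "gauss_step m \<beta> S F ?w \<le> gauss_step m \<beta> (\<lambda>_. u *\<^sub>R S (x m) + (1 - u) *\<^sub>R S (y m)) F ?w"
    using S[OF u] by (intro gauss_step_mono[OF N p F])
  \<comment> \<open>The three Gaussian steps now share the same noise \<open>z\<close> and the new
    states are affinely related, so the convexity of \<open>F\<close> applies for each
    \<open>z\<close>.\<close>
  also have "\<dots> \<le> (\<integral>z. u * F (x(Suc m := \<beta> (x m) + S (x m) *v z))
        + (1 - u) * F (y(Suc m := \<beta> (y m) + S (y m) *v z)) \<partial>std_normal_vec)"
    unfolding gauss_step_def
  proof (rule integral_mono)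
    fix z :: "real^'q"
    have "?w(Suc m := \<beta> (?w m) + (u *\<^sub>R S (x m) + (1 - u) *\<^sub>R S (y m)) *v z)
      = (\<lambda>i. u *\<^sub>R (x(Suc m := \<beta> (x m) + S (x m) *v z)) i
          + (1 - u) *\<^sub>R (y(Suc m := \<beta> (y m) + S (y m) *v z)) i)"
      unfolding \<beta>w
      by (auto simp: matrix_vector_mult_add_rdistrib scaleR_right_distrib simp flip: scaleR_matrix_vector_assoc)
    then show "F (?w(Suc m := \<beta> (?w m) + (u *\<^sub>R S (x m) + (1 - u) *\<^sub>R S (y m)) *v z))
       \<le> u * F (x(Suc m := \<beta> (x m) + S (x m) *v z)) + (1 - u) * F (y(Suc m := \<beta> (y m) + S (y m) *v z))"
      using path_functional_convex[OF F, of u "x(Suc m := \<beta> (x m) + S (x m) *v z)"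
          "y(Suc m := \<beta> (y m) + S (y m) *v z)"] u by (simp only: atLeastAtMost_iff)
  qed (auto intro!: int Bochner_Integration.integrable_add integrable_mult_right)
  also have "\<dots> = u * gauss_step m \<beta> S F x + (1 - u) * gauss_step m \<beta> S F y"
    using int by (simp add: gauss_step_def)
  finally show "gauss_step m \<beta> S F ?w \<le> u * gauss_step m \<beta> S F x + (1 - u) * gauss_step m \<beta> S F y" .
next
  interpret prob_space "std_normal_vec :: (real^'q) measure" by (rule N)
  note int = integrable_gauss_step[OF N p F]
  obtain C where C: "C \<ge> 0" "\<And>x. \<bar>F x\<bar> \<le> C * (1 + (\<Sum>i\<le>Suc m. norm (x i) powr p))"
    using path_functional_growth[OF F] by blast
  obtain c where c: "c \<ge> 0" "\<And>x z. norm (\<beta> x + S x *v z) powr p \<le> c * ((1 + norm x powr p) * (1 + norm z powr p))"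
    using affine_step_powr_bound[OF growth p] by blast
  define E where "E = (\<integral>z. 1 + norm z powr p \<partial>(std_normal_vec :: (real^'q) measure))"
  have E: "0 \<le> E" unfolding E_def by (intro integral_nonneg_AE) auto
  have intE: "integrable (std_normal_vec :: (real^'q) measure) (\<lambda>z. 1 + norm z powr p)"
    using integrable_norm_powr_std_normal_vec[OF N p]
    by (intro Bochner_Integration.integrable_add integrable_const)
  show "\<exists>C\<ge>0. \<forall>x. \<bar>gauss_step m \<beta> S F x\<bar> \<le> C * (1 + (\<Sum>i\<le>m. norm (x i) powr p))"
  proof (intro exI conjI allI)
    show "0 \<le> C * (1 + c * E)" using C c E by simp
    fix x :: "nat \<Rightarrow> real^'d"
    define s where "s = (\<Sum>i\<le>m. norm (x i) powr p)"
    have s: "norm (x m) powr p \<le> s" unfolding s_def by (intro member_le_sum) auto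
    have s0: "0 \<le> s" by (simp add: s_def sum_nonneg)
    have "\<bar>gauss_step m \<beta> S F x\<bar> \<le> (\<integral>z. \<bar>F (x(Suc m := \<beta> (x m) + S (x m) *v z))\<bar> \<partial>std_normal_vec)"
      unfolding gauss_step_def by (rule integral_abs_bound)
    also have "\<dots> \<le> (\<integral>z. C * (1 + s + c * (1 + s) * (1 + norm z powr p)) \<partial>(std_normal_vec :: (real^'q) measure))"
    proof (rule integral_mono)
      fix z :: "real^'q"
      let ?y = "\<beta> (x m) + S (x m) *v z"
      have "\<bar>F (x(Suc m := ?y))\<bar> \<le> C * (1 + (s + norm ?y powr p))"
        using C(2)[of "x(Suc m := ?y)"] by (simp add: s_def)
      also have "norm ?y powr p \<le> c * ((1 + s) * (1 + norm z powr p))"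
        by (rule order_trans[OF c(2)]) (use c(1) s in \<open>intro mult_left_mono mult_right_mono\<close>, auto)
      finally show "\<bar>F (x(Suc m := ?y))\<bar> \<le> C * (1 + s + c * (1 + s) * (1 + norm z powr p))"
        using C(1) by (simp add: mult.assoc mult_left_mono add.assoc)
    qed (auto intro!: integrable_abs int integrable_mult_right Bochner_Integration.integrable_add intE
          integrable_const)
    also have "\<dots> = C * (1 + s + c * (1 + s) * E)"
    proof -
      have "expectation (\<lambda>z. a + b * (1 + norm z powr p)) = a + b * E" for a b
      proof -
        have "expectation (\<lambda>z. a + b * (1 + norm z powr p))
           = expectation (\<lambda>_. a) + expectation (\<lambda>z. b * (1 + norm z powr p))"
          by (rule Bochner_Integration.integral_add) (intro integrable_const integrable_mult_right intE)+
        then show ?thesis using prob_space by (simp add: E_def)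
      qed
      then show ?thesis by simp
    qed
    also have "\<dots> = C * (1 + c * E) * (1 + s)" by (simp add: algebra_simps)
    finally show "\<bar>gauss_step m \<beta> S F x\<bar> \<le> C * (1 + c * E) * (1 + (\<Sum>i\<le>m. norm (x i) powr p))"
      by (simp add: s_def)
  qed
qed

section \<open>Convex order\<close>

text \<open>A downward cone with apex on the graph takes the place of a supporting hyperplane. At
  the origin it bounds \<open>\<phi>\<close> from below by a function of linear growth; at an
  arbitrary point its slope tells when the regularization becomes exact.\<close>

lemma convex_lower_cone:
  fixes \<phi> :: "'a::euclidean_space \<Rightarrow> real"
  assumes \<phi>: "convex_on UNIV \<phi>"
  shows "\<exists>K\<ge>0. \<forall>y. \<phi> x - K * norm (y - x) \<le> \<phi> y"
proof -
  have "continuous_on (cball x 1) \<phi>"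
    using convex_on_continuous[OF open_UNIV \<phi>] continuous_on_subset by blast
  then have "bounded (\<phi> ` cball x 1)"
    by (intro compact_imp_bounded compact_continuous_image) auto
  then obtain C where "\<forall>v\<in>\<phi> ` cball x 1. norm v \<le> C"
    unfolding bounded_iff by blast
  then have C: "\<bar>\<phi> z\<bar> \<le> C" if "z \<in> cball x 1" for z
    using that by simp
  show ?thesis
  proof (intro exI conjI allI)
    show "0 \<le> C - \<phi> x" using C[of x] by simp
    fix y
    define r where "r = norm (y - x)"
    show "\<phi> x - (C - \<phi> x) * norm (y - x) \<le> \<phi> y"
    proof (cases "y = x")
      case False
      then have r: "r > 0" by (simp add: r_def)
      \<comment> \<open>\<open>z\<close> is the point at distance 1 from \<open>x\<close> on the
        side opposite to \<open>y\<close>. As \<open>x\<close> lies between \<open>y\<close> and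
        \<open>z\<close>, a small value at \<open>y\<close> would force a value above
        \<open>C\<close> at \<open>z\<close>.\<close>
      define z where "z = x - (1 / r) *\<^sub>R (y - x)"
      have "dist x z = 1" using r by (simp add: z_def dist_norm r_def)
      then have z: "\<phi> z \<le> C" using C[of z] by simp
      define t where "t = r / (1 + r)"
      have t: "0 \<le> t" "t \<le> 1" "1 - t = 1 / (1 + r)" using r by (auto simp: t_def field_simps)
      have "(1 + r) *\<^sub>R ((1 - t) *\<^sub>R y + t *\<^sub>R z) = y + r *\<^sub>R z"
        using r unfolding t(3) scaleR_right_distrib by (simp add: t_def)
      also have "\<dots> = (1 + r) *\<^sub>R x" using r by (simp add: z_def algebra_simps)
      finally have "x = (1 - t) *\<^sub>R y + t *\<^sub>R z" using r by simp
      then have "\<phi> x \<le> (1 - t) * \<phi> y + t * \<phi> z"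
        using convex_onD[OF \<phi>, of t y z] t by simp
      then have "(1 + r) * \<phi> x \<le> (1 + r) * ((1 - t) * \<phi> y + t * \<phi> z)"
        using r by (intro mult_left_mono) auto
      also have "\<dots> = \<phi> y + r * \<phi> z"
        using r unfolding t(3) distrib_left by (simp add: t_def)
      also have "\<dots> \<le> \<phi> y + r * C" using z r by simp
      finally show ?thesis by (simp add: r_def algebra_simps)
    qed simp
  qed
qed

text \<open>The Pasch-Hausdorff envelope: the infimal convolution of \<open>\<phi>\<close> with
  \<open>n\<close> times the norm. Once \<open>n\<close> is at least the slope of a cone below
  \<open>\<phi>\<close>, the infimum is over a set bounded below, and the result is the greatest
  \<open>n\<close>-Lipschitz minorant.\<close>

definition lipschitz_minorant :: "real \<Rightarrow> ('a::real_normed_vector \<Rightarrow> real) \<Rightarrow> 'a \<Rightarrow> real" where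
  "lipschitz_minorant n \<phi> x = (INF y. \<phi> y + n * norm (x - y))"

context
  fixes \<phi> :: "'a::euclidean_space \<Rightarrow> real" and K :: real
  assumes \<phi>: "convex_on UNIV \<phi>"
    and K: "0 \<le> K" "\<And>y. \<phi> 0 - K * norm y \<le> \<phi> y"
begin

lemma lipschitz_minorant_bdd:
  assumes n: "K \<le> n"
  shows "\<phi> 0 - n * norm x \<le> \<phi> y + n * norm (x - y)"
proof -
  have "K * norm y \<le> n * norm y" using n by (rule mult_right_mono) simp
  also have "\<dots> \<le> n * (norm x + norm (x - y))"
    using n K norm_triangle_sub[of y x] by (intro mult_left_mono) (auto simp: norm_minus_commute)
  finally show ?thesis using K(2)[of y] by (simp add: algebra_simps)
qed

lemma lipschitz_minorant_lower:
  assumes n: "K \<le> n" shows "lipschitz_minorant n \<phi> x \<le> \<phi> y + n * norm (x - y)"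
  unfolding lipschitz_minorant_def
  by (rule cINF_lower[OF _ UNIV_I]) (rule bdd_belowI2, rule lipschitz_minorant_bdd[OF n])

lemma lipschitz_minorant_greatest:
  "(\<And>y. c \<le> \<phi> y + n * norm (x - y)) \<Longrightarrow> c \<le> lipschitz_minorant n \<phi> x"
  unfolding lipschitz_minorant_def by (rule cINF_greatest) auto

lemma abs_lipschitz_minorant_le:
  assumes n: "K \<le> n" shows "\<bar>lipschitz_minorant n \<phi> x\<bar> \<le> (\<bar>\<phi> 0\<bar> + n) * (1 + norm x)"
proof -
  have "lipschitz_minorant n \<phi> x \<le> \<phi> 0 + n * norm x"
    using lipschitz_minorant_lower[OF n, of x 0] by simp
  moreover have "\<phi> 0 - n * norm x \<le> lipschitz_minorant n \<phi> x"
    by (intro lipschitz_minorant_greatest lipschitz_minorant_bdd n)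
  ultimately have "\<bar>lipschitz_minorant n \<phi> x\<bar> \<le> \<bar>\<phi> 0\<bar> + n * norm x" by linarith
  also have "\<dots> \<le> (\<bar>\<phi> 0\<bar> + n) * (1 + norm x)"
    using n K by (simp add: algebra_simps)
  finally show ?thesis .
qed

lemma lipschitz_minorant_le: "K \<le> n \<Longrightarrow> lipschitz_minorant n \<phi> x \<le> \<phi> x"
  using lipschitz_minorant_lower[of n x x] by simp

lemma lipschitz_minorant_mono:
  assumes "K \<le> n" "n \<le> n'"
  shows "lipschitz_minorant n \<phi> x \<le> lipschitz_minorant n' \<phi> x"
proof (rule lipschitz_minorant_greatest)
  fix y
  have "n * norm (x - y) \<le> n' * norm (x - y)" using assms by (intro mult_right_mono) auto
  then show "lipschitz_minorant n \<phi> x \<le> \<phi> y + n' * norm (x - y)"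
    using lipschitz_minorant_lower[OF assms(1), of x y] by linarith
qed

text \<open>Once \<open>n\<close> exceeds the slope of a cone touching the graph at
  \<open>x\<close>, no other point can undercut \<open>\<phi> x\<close>. Hence the envelopes
  converge pointwise by becoming stationary.\<close>

lemma lipschitz_minorant_eq:
  assumes "K \<le> n" "\<And>y. \<phi> x - n * norm (y - x) \<le> \<phi> y"
  shows "lipschitz_minorant n \<phi> x = \<phi> x"
proof (rule antisym[OF lipschitz_minorant_le[OF assms(1)] lipschitz_minorant_greatest])
  show "\<phi> x \<le> \<phi> y + n * norm (x - y)" for y
    using assms(2)[of y] by (simp add: norm_minus_commute)
qed

lemma convex_lipschitz_minorant:
  assumes n: "K \<le> n" shows "convex_on UNIV (lipschitz_minorant n \<phi>)"
proof (rule convex_onI)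
  fix t :: real and x y :: 'a
  assume t: "0 < t" "t < 1"
  let ?L = "lipschitz_minorant n \<phi>"
  let ?s = "?L ((1 - t) *\<^sub>R x + t *\<^sub>R y)"
  have main: "?s \<le> (1 - t) * (\<phi> a + n * norm (x - a)) + t * (\<phi> b + n * norm (y - b))" for a b
  proof -
    have "?s \<le> \<phi> ((1 - t) *\<^sub>R a + t *\<^sub>R b) + n * norm (((1 - t) *\<^sub>R x + t *\<^sub>R y) - ((1 - t) *\<^sub>R a + t *\<^sub>R b))"
      by (rule lipschitz_minorant_lower[OF n])
    moreover have "\<phi> ((1 - t) *\<^sub>R a + t *\<^sub>R b) \<le> (1 - t) * \<phi> a + t * \<phi> b"
      using convex_onD[OF \<phi>, of t a b] t by simp
    moreover have "norm (((1 - t) *\<^sub>R x + t *\<^sub>R y) - ((1 - t) *\<^sub>R a + t *\<^sub>R b))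
       \<le> (1 - t) * norm (x - a) + t * norm (y - b)"
    proof -
      have "((1 - t) *\<^sub>R x + t *\<^sub>R y) - ((1 - t) *\<^sub>R a + t *\<^sub>R b) = (1 - t) *\<^sub>R (x - a) + t *\<^sub>R (y - b)"
        by (simp add: algebra_simps)
      then show ?thesis
        using norm_triangle_ineq[of "(1 - t) *\<^sub>R (x - a)" "t *\<^sub>R (y - b)"] t by simp
    qed
    then have "n * norm (((1 - t) *\<^sub>R x + t *\<^sub>R y) - ((1 - t) *\<^sub>R a + t *\<^sub>R b))
       \<le> n * ((1 - t) * norm (x - a) + t * norm (y - b))"
      using n K by (intro mult_left_mono) auto
    ultimately show ?thesis by (simp add: algebra_simps)
  qed
  \<comment> \<open>The two infima are taken one after the other, over \<open>b\<close> and over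
    \<open>a\<close>, by isolating the corresponding term of \<open>main\<close>; no approximate
    minimizers are chosen.\<close>
  have "(?s - (1 - t) * (\<phi> a + n * norm (x - a))) / t \<le> ?L y" for a
    using main[of a] t by (intro lipschitz_minorant_greatest) (simp add: field_simps)
  then have "(?s - t * ?L y) / (1 - t) \<le> ?L x"
    using t by (intro lipschitz_minorant_greatest) (simp add: field_simps)
  then show "?s \<le> (1 - t) * ?L x + t * ?L y" using t by (simp add: field_simps)
qed simp

end

section \<open>Extended integrals and tests for the convex order\<close>

lemma ext_integral_integrable:
  "integrable M f \<Longrightarrow> ext_integral M f = ereal (integral\<^sup>L M f)"
  by (cases "\<integral>\<^sup>+x. ennreal (f x) \<partial>M"; cases "\<integral>\<^sup>+x. ennreal (- f x) \<partial>M")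
    (auto simp: ext_integral_def real_lebesgue_integral_def real_integrable_def)

lemma prob_moment_mono:
  assumes "1 \<le> p" "\<mu> \<in> prob_moment p" shows "\<mu> \<in> prob_moment 1"
proof -
  interpret prob_space \<mu> using assms by (simp add: prob_moment_def)
  have [measurable_cong]: "sets \<mu> = sets borel" using assms by (simp add: prob_moment_def)
  have "integrable \<mu> (\<lambda>x. norm x powr 1)"
  proof (rule Bochner_Integration.integrable_bound)
    show "integrable \<mu> (\<lambda>x. 1 + norm x powr p)"
      using assms by (auto simp: prob_moment_def)
    have "t powr 1 \<le> 1 + t powr p" if "0 \<le> t" for t :: real
      using that assms(1) powr_mono[of 1 p t] by (cases "t \<le> 1") (auto simp: add_increasing2)
    then show "AE x in \<mu>. norm (norm x powr 1) \<le> norm (1 + norm x powr p)"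
      by (intro AE_I2) (simp add: abs_of_nonneg)
  qed measurable
  then show ?thesis using assms by (simp add: prob_moment_def)
qed

lemma convex_order_integral:
  assumes "\<mu> \<preceq>cv \<nu>" "convex_on UNIV \<phi>" "integrable \<mu> \<phi>" "integrable \<nu> \<phi>"
  shows "integral\<^sup>L \<mu> \<phi> \<le> integral\<^sup>L \<nu> \<phi>"
proof -
  have "ext_integral \<mu> \<phi> \<le> ext_integral \<nu> \<phi>" using assms by (simp add: convex_order_def)
  then show ?thesis using assms by (simp add: ext_integral_integrable)
qed

text \<open>Test functions of linear growth suffice, because every convex function is the increasing
  limit of convex Lipschitz envelopes. This lets a comparison for functionals of controlled growth
  yield the full convex order.\<close>

lemma convex_orderI:
  fixes \<mu> \<nu> :: "'a::euclidean_space measure"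
  assumes \<mu>: "\<mu> \<in> prob_moment 1" and \<nu>: "\<nu> \<in> prob_moment 1"
    and le: "\<And>\<psi> c. convex_on UNIV \<psi> \<Longrightarrow> (\<And>x. \<bar>\<psi> x\<bar> \<le> c * (1 + norm x)) \<Longrightarrow>
         integral\<^sup>L \<mu> \<psi> \<le> integral\<^sup>L \<nu> \<psi>"
  shows "\<mu> \<preceq>cv \<nu>"
  unfolding convex_order_def
proof (intro conjI \<mu> \<nu> allI impI)
  fix \<phi> :: "'a \<Rightarrow> real" assume \<phi>: "convex_on UNIV \<phi>"
  have [measurable_cong]: "sets \<mu> = sets borel" "sets \<nu> = sets borel"
    using \<mu> \<nu> by (auto simp: prob_moment_def)
  note borel_measurable_convex[OF \<phi>, measurable]
  obtain K where K: "0 \<le> K" "\<And>y. \<phi> 0 - K * norm y \<le> \<phi> y"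
    using convex_lower_cone[OF \<phi>, of 0] by auto
  \<comment> \<open>Starting at the slope \<open>K\<close> of a cone below \<open>\<phi>\<close>
    keeps all the envelopes finite.\<close>
  define \<psi> where "\<psi> n = lipschitz_minorant (K + real n) \<phi>" for n :: nat
  have \<psi>: "convex_on UNIV (\<psi> n)" "\<bar>\<psi> n x\<bar> \<le> (\<bar>\<phi> 0\<bar> + (K + real n)) * (1 + norm x)"
     "\<psi> n x \<le> \<phi> x" for n x
    unfolding \<psi>_def
    using convex_lipschitz_minorant[OF \<phi> K] abs_lipschitz_minorant_le[OF \<phi> K] lipschitz_minorant_le[OF \<phi> K]
    by auto
  note borel_measurable_convex[OF \<psi>(1), measurable]
  have int1: "integrable \<kappa> (\<lambda>x. c * (1 + norm x))" if "\<kappa> \<in> prob_moment 1" for c and \<kappa> :: "'a measure"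
  proof -
    interpret prob_space \<kappa> using that by (simp add: prob_moment_def)
    show ?thesis using that
      by (intro integrable_mult_right Bochner_Integration.integrable_add integrable_const)
        (simp add: prob_moment_def)
  qed
  have int: "integrable \<mu> (\<psi> n)" "integrable \<nu> (\<psi> n)" for n
  proof -
    have *: "AE x in \<kappa>. norm (\<psi> n x) \<le> norm ((\<bar>\<phi> 0\<bar> + (K + real n)) * (1 + norm x))" for \<kappa> :: "'a measure"
      using \<psi>(2)[of n] by (intro AE_I2) (simp only: real_norm_def order_trans[OF _ abs_ge_self])
    show "integrable \<mu> (\<psi> n)" by (rule Bochner_Integration.integrable_bound[OF int1[OF \<mu>] _ *]) measurable
    show "integrable \<nu> (\<psi> n)" by (rule Bochner_Integration.integrable_bound[OF int1[OF \<nu>] _ *]) measurable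
  qed
  show "ext_integral \<mu> \<phi> \<le> ext_integral \<nu> \<phi>"
  proof (cases "integrable \<nu> \<phi>")
    case True
    have "integral\<^sup>L \<mu> (\<psi> n) \<le> integral\<^sup>L \<nu> \<phi>" for n
    proof -
      have "integral\<^sup>L \<mu> (\<psi> n) \<le> integral\<^sup>L \<nu> (\<psi> n)" using \<psi>(1,2) by (rule le)
      also have "\<dots> \<le> integral\<^sup>L \<nu> \<phi>" using int True \<psi>(3) by (intro integral_mono)
      finally show ?thesis .
    qed
    moreover have mono: "mono (\<lambda>n. \<psi> n x)" for x
      unfolding \<psi>_def using K by (intro monoI lipschitz_minorant_mono[OF \<phi> K]) auto
    moreover have "mono (\<lambda>n. integral\<^sup>L \<mu> (\<psi> n))"
      using int mono by (intro monoI integral_mono) (auto dest: monoD)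
    \<comment> \<open>The integrals increase and are bounded by the \<open>\<nu>\<close>-integral of
      \<open>\<phi>\<close>; monotone convergence then gives the \<open>\<mu>\<close>-integrability
      of \<open>\<phi>\<close> together with the inequality.\<close>
    ultimately obtain l where l: "(\<lambda>n. integral\<^sup>L \<mu> (\<psi> n)) \<longlonglongrightarrow> l" "l \<le> integral\<^sup>L \<nu> \<phi>"
      by (metis incseq_convergent LIMSEQ_le_const2)
    have "(\<lambda>n. \<psi> n x) \<longlonglongrightarrow> \<phi> x" for x
    proof -
      obtain k where k: "\<And>y. \<phi> x - k * norm (y - x) \<le> \<phi> y" using convex_lower_cone[OF \<phi>, of x] by auto
      obtain N :: nat where N: "k \<le> real N" using real_arch_simple by blast
      have "\<psi> n x = \<phi> x" if "n \<ge> N" for n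
        unfolding \<psi>_def
      proof (rule lipschitz_minorant_eq[OF \<phi> K])
        fix y
        have "k * norm (y - x) \<le> (K + real n) * norm (y - x)"
          using N K that by (intro mult_right_mono) auto
        then show "\<phi> x - (K + real n) * norm (y - x) \<le> \<phi> y" using k[of y] by linarith
      qed simp
      then show ?thesis by (intro tendsto_eventually) (auto simp: eventually_sequentially)
    qed
    then have lim: "AE x in \<mu>. (\<lambda>n. \<psi> n x) \<longlonglongrightarrow> \<phi> x" by simp
    have AEmono: "AE x in \<mu>. mono (\<lambda>n. \<psi> n x)" using mono by simp
    have "\<phi> \<in> borel_measurable \<mu>" by measurable
    then have "integrable \<mu> \<phi>" "integral\<^sup>L \<mu> \<phi> = l"
      using integrable_monotone_convergence[OF int(1) AEmono lim l(1)]
        integral_monotone_convergence[OF int(1) AEmono lim l(1)] by blast+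
    then show ?thesis using l(2) True by (simp add: ext_integral_integrable)
  next
    case False
    \<comment> \<open>The envelope \<open>\<psi> 0\<close> lies below \<open>\<phi>\<close> and is
      integrable, so the negative part of \<open>\<phi>\<close> is integrable; failure of
      integrability means that the right-hand side is infinite.\<close>
    have "(\<integral>\<^sup>+x. ennreal (- \<phi> x) \<partial>\<nu>) \<le> (\<integral>\<^sup>+x. ennreal (\<bar>\<psi> 0 x\<bar>) \<partial>\<nu>)"
      using \<psi>(3)[of 0] by (intro nn_integral_mono ennreal_leI) (smt (verit))
    also have "\<dots> < \<infinity>" using int(2)[of 0] by (simp add: integrable_iff_bounded)
    finally have neg: "(\<integral>\<^sup>+x. ennreal (- \<phi> x) \<partial>\<nu>) < \<infinity>" .
    then have "(\<integral>\<^sup>+x. ennreal (\<phi> x) \<partial>\<nu>) = \<infinity>"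
      using False by (auto simp: real_integrable_def)
    then have "ext_integral \<nu> \<phi> = \<infinity>"
      using neg by (cases "\<integral>\<^sup>+x. ennreal (- \<phi> x) \<partial>\<nu>") (auto simp: ext_integral_def)
    then show ?thesis by simp
  qed
qed

text \<open>The diagonal coupling costs nothing. With equal measures the regularity assumption thus
  becomes a Lipschitz bound in the state.\<close>

lemma wasserstein_self:
  assumes "\<mu> \<in> prob_moment p" shows "wasserstein p \<mu> \<mu> = 0"
proof -
  have [measurable_cong]: "sets \<mu> = sets borel" using assms by (simp add: prob_moment_def)
  define \<pi> where "\<pi> = distr \<mu> (borel \<Otimes>\<^sub>M borel) (\<lambda>x. (x, x))"
  have "distr \<mu> borel (\<lambda>x. x) = \<mu>" using assms by (intro distr_id2) (simp add: prob_moment_def)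
  then have "\<pi> \<in> couplings \<mu> \<mu>"
    by (simp add: couplings_def \<pi>_def distr_distr o_def)
  moreover have "(\<integral>\<^sup>+ z. ennreal (norm (fst z - snd z) powr p) \<partial>\<pi>) = 0"
    unfolding \<pi>_def by (subst nn_integral_distr) auto
  ultimately have "(INF \<pi>\<in>couplings \<mu> \<mu>. \<integral>\<^sup>+ z. ennreal (norm (fst z - snd z) powr p) \<partial>\<pi>) \<le> 0"
    by (intro INF_lower2[of \<pi>]) (simp_all only: order_refl)
  then show ?thesis by (simp add: wasserstein_def)
qed

section \<open>Independence of the noise from the past\<close>

text \<open>Index 0 stands for the pair of initial values and a positive index \<open>i\<close> for
  \<open>Z i\<close>, so that a single independent family of pi-systems carries both independence
  hypotheses.\<close>

definition noise_events ::
    "'w measure \<Rightarrow> ('w \<Rightarrow> 'a::topological_space \<times> 'a) \<Rightarrow> (nat \<Rightarrow> 'w \<Rightarrow> 'b::topological_space) \<Rightarrow> nat \<Rightarrow> 'w set set" where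
  "noise_events P V Z i =
     (if i = 0 then {V -` A \<inter> space P | A. A \<in> sets (borel \<Otimes>\<^sub>M borel)}
      else {Z i -` A \<inter> space P | A. A \<in> sets borel})"

text \<open>The natural filtration of the initial values and the noise. It is a measure for the sake
  of \<open>measurable\<close>; only its space and its sets matter.\<close>

definition history ::
    "'w measure \<Rightarrow> ('w \<Rightarrow> 'a::topological_space \<times> 'a) \<Rightarrow> (nat \<Rightarrow> 'w \<Rightarrow> 'b::topological_space) \<Rightarrow> nat \<Rightarrow> 'w measure" where
  "history P V Z m = sigma (space P) (\<Union>i\<le>m. noise_events P V Z i)"

lemma Int_stable_vimages: "Int_stable {f -` A \<inter> S | A. A \<in> sets M}"
proof (rule Int_stableI)
  fix a b assume "a \<in> {f -` A \<inter> S |A. A \<in> sets M}" "b \<in> {f -` A \<inter> S |A. A \<in> sets M}"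
  then obtain A B where "A \<in> sets M" "B \<in> sets M" "a = f -` A \<inter> S" "b = f -` B \<inter> S" by blast
  then have "A \<inter> B \<in> sets M" "a \<inter> b = f -` (A \<inter> B) \<inter> S" by auto
  then show "a \<inter> b \<in> {f -` A \<inter> S |A. A \<in> sets M}" by blast
qed

lemma noise_events_subset: "noise_events P V Z i \<subseteq> Pow (space P)"
  by (auto simp: noise_events_def)

lemma space_history [simp]: "space (history P V Z m) = space P"
  unfolding history_def by (rule space_measure_of) (use noise_events_subset in blast)

lemma sets_history: "sets (history P V Z m) = sigma_sets (space P) (\<Union>i\<le>m. noise_events P V Z i)"
  unfolding history_def by (rule sets_measure_of) (use noise_events_subset in blast)

lemma sets_history_mono: "m \<le> n \<Longrightarrow> sets (history P V Z m) \<subseteq> sets (history P V Z n)"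
  unfolding sets_history by (intro sigma_sets_mono' UN_mono) auto

lemma measurable_history_mono:
  assumes "m \<le> n" "f \<in> measurable (history P V Z m) N"
  shows "f \<in> measurable (history P V Z n) N"
  using assms(2) sets_history_mono[OF assms(1), of P V Z] by (auto simp: measurable_def)

lemma measurable_history_init: "V \<in> measurable (history P V Z m) (borel \<Otimes>\<^sub>M borel)"
proof (rule measurableI)
  fix A :: "('b \<times> 'b) set" assume "A \<in> sets (borel \<Otimes>\<^sub>M borel)"
  then have "V -` A \<inter> space P \<in> noise_events P V Z 0" by (auto simp: noise_events_def)
  then show "V -` A \<inter> space (history P V Z m) \<in> sets (history P V Z m)"
    unfolding sets_history by (auto intro!: sigma_sets.Basic)
qed (simp add: space_pair_measure)

lemma measurable_history_noise:
  assumes "0 < i" "i \<le> m" shows "Z i \<in> measurable (history P V Z m) borel"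
proof (rule measurableI)
  fix A :: "'b set" assume "A \<in> sets borel"
  then have "Z i -` A \<inter> space P \<in> noise_events P V Z i" using assms by (auto simp: noise_events_def)
  then show "Z i -` A \<inter> space (history P V Z m) \<in> sets (history P V Z m)"
    unfolding sets_history using assms by (auto intro!: sigma_sets.Basic)
qed simp

context prob_space
begin

lemma indep_sets_noise_events:
  fixes V :: "'a \<Rightarrow> 'b::topological_space \<times> 'b" and Z :: "nat \<Rightarrow> 'a \<Rightarrow> 'c::topological_space"
  assumes Z: "indep_vars (\<lambda>_. borel) Z {1..N}"
    and V: "indep_pair M (borel \<Otimes>\<^sub>M borel) V (PiM {1..N} (\<lambda>_. borel)) (\<lambda>\<omega>. \<lambda>m\<in>{1..N}. Z m \<omega>)"
  shows "indep_sets (noise_events M V Z) {0..N}"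
proof (rule indep_setsI)
  have Zm: "random_variable borel (Z i)" if "i \<in> {1..N}" for i
    using Z that by (auto simp: indep_vars_def2)
  have Vm: "random_variable (borel \<Otimes>\<^sub>M borel) V" using V by (simp add: indep_pair_def)
  show "noise_events M V Z i \<subseteq> events" if "i \<in> {0..N}" for i
    using that Vm Zm[of i] by (auto simp: noise_events_def intro: measurable_sets)
  have ZI: "indep_sets (noise_events M V Z) {1..N}"
    using Z[unfolded indep_vars_def2, THEN conjunct2]
    by (rule indep_sets_mono_sets) (simp add: noise_events_def)
  fix A J assume J: "J \<noteq> {}" "J \<subseteq> {0..N}" "finite J" and A: "\<forall>j\<in>J. A j \<in> noise_events M V Z j"
  define J' where "J' = J - {0}"
  have J': "J' \<subseteq> {1..N}" "finite J'" using J by (auto simp: J'_def Suc_le_eq)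
  show "prob (\<Inter>j\<in>J. A j) = (\<Prod>j\<in>J. prob (A j))"
  \<comment> \<open>Only an index set containing both 0 and a positive index mixes the two
    hypotheses.\<close>
  proof (cases "0 \<in> J \<and> J' \<noteq> {}")
    case False
    then consider "J' = J" | "J = {0}" using J by (auto simp: J'_def)
    then show ?thesis
    proof cases
      case 1
      then show ?thesis using J J' A by (intro indep_setsD[OF ZI]) auto
    qed simp
  next
    case True
    then have J0: "J = insert 0 J'" "0 \<notin> J'" by (auto simp: J'_def)
    obtain B0 where B0: "B0 \<in> sets (borel \<Otimes>\<^sub>M borel)" "A 0 = V -` B0 \<inter> space M"
      using A J0 by (auto simp: noise_events_def)
    have "\<forall>j\<in>J'. \<exists>B. B \<in> sets borel \<and> A j = Z j -` B \<inter> space M"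
    proof
      fix j assume "j \<in> J'"
      then have "j \<noteq> 0" "A j \<in> noise_events M V Z j" using A J0 by (metis insertCI)+
      then show "\<exists>B. B \<in> sets borel \<and> A j = Z j -` B \<inter> space M" by (auto simp: noise_events_def)
    qed
    then obtain B where B: "\<And>j. j \<in> J' \<Longrightarrow> B j \<in> sets borel"
        "\<And>j. j \<in> J' \<Longrightarrow> A j = Z j -` B j \<inter> space M" by metis
    let ?S = "PiM {1..N} (\<lambda>_. borel :: 'c measure)"
    \<comment> \<open>The events with positive index are collected into one cylinder for the whole
      noise vector, which is the object that is independent of \<open>V\<close>.\<close>
    define C where "C = {f \<in> space ?S. \<forall>j\<in>J'. f j \<in> B j}"
    have C: "C \<in> sets ?S"
      unfolding C_def using J' B(1) by (intro sets.sets_Collect_finite_All measurable_sets_Collect[OF measurable_component_singleton]) auto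
    have Ceq: "(\<Inter>j\<in>J'. A j) = (\<lambda>\<omega>. \<lambda>m\<in>{1..N}. Z m \<omega>) -` C \<inter> space M"
      using J' True B(2) by (auto simp: C_def space_PiM subset_iff)
    have "prob (A 0 \<inter> (\<Inter>j\<in>J'. A j)) = prob (A 0) * prob (\<Inter>j\<in>J'. A j)"
      unfolding Ceq B0(2) using V B0(1) C unfolding indep_pair_def by (intro indep_setD) auto
    also have "prob (\<Inter>j\<in>J'. A j) = (\<Prod>j\<in>J'. prob (A j))"
      using True J' A J0 by (intro indep_setsD[OF ZI]) auto
    finally show ?thesis using J0 J' by simp
  qed
qed

text \<open>The indices up to \<open>m\<close> and the index \<open>Suc m\<close> form disjoint
  blocks of an independent family of pi-systems, so the sigma-algebras generated by the blocks are
  independent.\<close>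

lemma prob_history_noise:
  fixes V :: "'a \<Rightarrow> 'b::topological_space \<times> 'b" and Z :: "nat \<Rightarrow> 'a \<Rightarrow> 'c::topological_space"
  assumes ind: "indep_sets (noise_events M V Z) {0..N}" and m: "m < N"
    and A: "A \<in> sets (history M V Z m)" and B: "B \<in> sets borel"
  shows "prob (A \<inter> (Z (Suc m) -` B \<inter> space M)) = prob A * prob (Z (Suc m) -` B \<inter> space M)"
proof -
  let ?I = "\<lambda>b. if b then {..m} else {Suc m}"
  have "indep_sets (\<lambda>b. sigma_sets (space M) (\<Union>i\<in>?I b. noise_events M V Z i)) UNIV"
  proof (rule indep_sets_collect_sigma)
    show "indep_sets (noise_events M V Z) (\<Union>b. ?I b)"
      using m by (intro indep_sets_mono_index[OF _ ind]) (auto split: if_splits)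
    show "Int_stable (noise_events M V Z i)" for i
      unfolding noise_events_def by (simp add: Int_stable_vimages)
    show "disjoint_family_on ?I UNIV" by (auto simp: disjoint_family_on_def)
  qed
  then have "indep_set (sigma_sets (space M) (\<Union>i\<in>{..m}. noise_events M V Z i))
     (sigma_sets (space M) (noise_events M V Z (Suc m)))"
    unfolding indep_set_def by (rule indep_sets_mono_sets) (auto split: bool.splits)
  then show ?thesis
    by (rule indep_setD)
      (use A B in \<open>auto simp: sets_history noise_events_def intro!: sigma_sets.Basic\<close>)
qed

text \<open>The target space \<open>S\<close> is left open because the past enters in two ways: as
  the current state, for the moments, and as the whole path, for the functionals.\<close>

lemma distr_history_noise:
  fixes V :: "'a \<Rightarrow> 'b::topological_space \<times> 'b" and Z :: "nat \<Rightarrow> 'a \<Rightarrow> 'c::topological_space"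
  assumes ind: "indep_sets (noise_events M V Z) {0..N}" and m: "m < N"
    and sub: "sets (history M V Z m) \<subseteq> events"
    and Z: "random_variable borel (Z (Suc m))"
    and U: "U \<in> measurable (history M V Z m) S"
  shows "distr M (S \<Otimes>\<^sub>M borel) (\<lambda>\<omega>. (U \<omega>, Z (Suc m) \<omega>)) = distr M S U \<Otimes>\<^sub>M distr M borel (Z (Suc m))"
proof (rule pair_measure_eqI[symmetric])
  have [measurable]: "random_variable S U"
    using U sub by (auto simp: measurable_def)
  note Z[measurable]
  show "sigma_finite_measure (distr M S U)"
    by (intro finite_measure.sigma_finite_measure finite_measure_distr) measurable
  show "sigma_finite_measure (distr M borel (Z (Suc m)))"
    by (intro finite_measure.sigma_finite_measure finite_measure_distr) measurable
  show "sets (distr M S U \<Otimes>\<^sub>M distr M borel (Z (Suc m))) = sets (distr M (S \<Otimes>\<^sub>M borel) (\<lambda>\<omega>. (U \<omega>, Z (Suc m) \<omega>)))"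
    by (simp cong: sets_pair_measure_cong)
  fix A B assume "A \<in> sets (distr M S U)" "B \<in> sets (distr M borel (Z (Suc m)))"
  then have [measurable]: "A \<in> sets S" "B \<in> sets borel" by auto
  have "U -` A \<inter> space M \<in> sets (history M V Z m)"
    using measurable_sets[OF U \<open>A \<in> sets S\<close>] by simp
  note prob_history_noise[OF ind m this \<open>B \<in> sets borel\<close>]
  moreover have "(\<lambda>\<omega>. (U \<omega>, Z (Suc m) \<omega>)) -` (A \<times> B) \<inter> space M
      = (U -` A \<inter> space M) \<inter> (Z (Suc m) -` B \<inter> space M)" by auto
  ultimately have "prob ((\<lambda>\<omega>. (U \<omega>, Z (Suc m) \<omega>)) -` (A \<times> B) \<inter> space M)
      = prob (U -` A \<inter> space M) * prob (Z (Suc m) -` B \<inter> space M)"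
    by simp
  then show "emeasure (distr M S U) A * emeasure (distr M borel (Z (Suc m))) B
      = emeasure (distr M (S \<Otimes>\<^sub>M borel) (\<lambda>\<omega>. (U \<omega>, Z (Suc m) \<omega>))) (A \<times> B)"
    by (simp add: emeasure_distr emeasure_eq_measure ennreal_mult)
qed

end

section \<open>The Euler scheme\<close>

lemma regular_coefficient_lipschitz:
  assumes "regular_coefficient T p \<rho> L L' N f" "0 \<le> t" "t \<le> T" "\<mu> \<in> prob_moment p"
  shows "N (f t x \<mu> - f t y \<mu>) \<le> L * norm (x - y)"
  using assms wasserstein_self[OF assms(4)] unfolding regular_coefficient_def
  by (metis add.right_neutral order_refl)

lemma lipschitz_imp_continuous:
  fixes f :: "'a::real_normed_vector \<Rightarrow> 'b::real_normed_vector"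
  assumes "\<And>x y. norm (f x - f y) \<le> L * norm (x - y)"
  shows "continuous_on UNIV f"
proof -
  have "norm (f x - f y) \<le> max 0 L * norm (x - y)" for x y
    using assms[of x y] mult_right_mono[of L "max 0 L" "norm (x - y)"] by simp
  then have "(max 0 L)-lipschitz_on UNIV f"
    by (intro lipschitz_onI) (auto simp: dist_norm)
  then show ?thesis by (rule lipschitz_on_continuous_on)
qed

text \<open>Regularity is assumed in the operator norm, while continuity and measurability refer to
  the type-class norm. Any constant serves, so the entries are simply added up.\<close>

lemma norm_matrix_le_op_norm:
  fixes A :: "real^'q^'d"
  shows "norm A \<le> CARD('d) * CARD('q) * op_norm A"
proof -
  have "norm A \<le> (\<Sum>i\<in>UNIV. norm (A $ i))"
    unfolding norm_vec_def[of A] by (rule L2_set_le_sum) auto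
  also have "\<dots> \<le> (\<Sum>i\<in>(UNIV::'d set). \<Sum>j\<in>(UNIV::'q set). \<bar>A $ i $ j\<bar>)"
    by (intro sum_mono norm_le_l1_cart)
  also have "\<dots> \<le> (\<Sum>i\<in>(UNIV::'d set). \<Sum>j\<in>(UNIV::'q set). op_norm A)"
    by (intro sum_mono) (simp add: op_norm_def matrix_component_le_onorm)
  finally show ?thesis by (simp add: mult.assoc)
qed

lemma op_norm_add_le: "op_norm (A + B) \<le> op_norm A + op_norm B"
proof -
  have "norm ((A + B) *v x) \<le> (op_norm A + op_norm B) * norm x" for x
    using norm_triangle_ineq[of "A *v x" "B *v x"] norm_mult_op_norm[of A x] norm_mult_op_norm[of B x]
    by (simp add: matrix_vector_mult_add_rdistrib distrib_right)
  then show ?thesis unfolding op_norm_def[of "A + B"] by (rule onorm_le)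
qed

lemma op_norm_scaleR: "op_norm (c *\<^sub>R A) = \<bar>c\<bar> * op_norm A"
proof -
  have "(*v) (c *\<^sub>R A) = (\<lambda>x. c *\<^sub>R (A *v x))" by (simp add: fun_eq_iff scaleR_matrix_vector_assoc)
  then show ?thesis
    unfolding op_norm_def by (simp add: onorm_scaleR linear_conv_bounded_linear[symmetric])
qed

lemma lipschitz_imp_linear_growth:
  fixes f :: "'a::real_normed_vector \<Rightarrow> 'b::real_vector"
  assumes lip: "\<And>x y. N (f x - f y) \<le> L * norm (x - y)" and L: "0 \<le> L"
    and N: "\<And>u v. N (u + v) \<le> N u + N v"
  shows "linear_growth f N"
  unfolding linear_growth_def
proof (intro exI conjI allI)
  fix x
  have "N (f x) \<le> N (f x - f 0) + N (f 0)" using N[of "f x - f 0" "f 0"] by simp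
  also have "\<dots> \<le> L * norm x + \<bar>N (f 0)\<bar>" using lip[of x 0] by simp
  also have "\<dots> \<le> (L + \<bar>N (f 0)\<bar>) * (1 + norm x)" using L by (simp add: algebra_simps)
  finally show "N (f x) \<le> (L + \<bar>N (f 0)\<bar>) * (1 + norm x)" .
qed (use L in simp)

text \<open>Together with \<open>diffusion_map\<close> this puts one Euler step, at frozen time and
  law, into the form \<open>\<beta> x + S x *v z\<close> with a standard normal
  \<open>z\<close>.\<close>

definition drift_map where "drift_map h b t \<mu> x = x + h *\<^sub>R b t x \<mu>"

definition diffusion_map where "diffusion_map h \<sigma> t \<mu> x = sqrt h *\<^sub>R \<sigma> t x \<mu>"

lemma euler_scheme_Suc:
  "euler_scheme P h b \<sigma> X0 Z (Suc m) \<omega> =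
     (let X = euler_scheme P h b \<sigma> X0 Z m; \<mu> = distr P borel X; t = real m * h
      in drift_map h b t \<mu> (X \<omega>) + diffusion_map h \<sigma> t \<mu> (X \<omega>) *v Z (Suc m) \<omega>)"
  by (simp add: Let_def drift_map_def diffusion_map_def scaleR_matrix_vector_assoc)

lemma affine_drift_map:
  assumes "affine_fun (\<lambda>x. b t x \<mu>)" shows "affine_fun (drift_map h b t \<mu>)"
proof -
  obtain g c where g: "linear g" "\<And>x. b t x \<mu> = g x + c" using assms by (auto simp: affine_fun_def)
  have "linear (\<lambda>x. x + h *\<^sub>R g x)"
    by (intro linear_compose_add linear_compose_scale_right linear_ident g)
  moreover have "drift_map h b t \<mu> x = (x + h *\<^sub>R g x) + h *\<^sub>R c" for x
    by (simp add: drift_map_def g scaleR_right_distrib)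
  ultimately show ?thesis unfolding affine_fun_def by blast
qed

context
  fixes T p \<rho> L L' h t :: real and \<mu> :: "(real^'d) measure"
  assumes t: "0 \<le> t" "t \<le> T" and \<mu>: "\<mu> \<in> prob_moment p" and L: "0 \<le> L" and h: "0 \<le> h"
begin

lemma drift_map_regular:
  assumes b: "regular_coefficient T p \<rho> L L' norm (b :: (real^'d, real^'d) coefficient)"
  shows "drift_map h b t \<mu> \<in> borel_measurable borel" and "linear_growth (drift_map h b t \<mu>) norm"
proof -
  have lip: "norm (drift_map h b t \<mu> x - drift_map h b t \<mu> y) \<le> (1 + h * L) * norm (x - y)" for x y
  proof -
    have "norm (drift_map h b t \<mu> x - drift_map h b t \<mu> y) \<le> norm (x - y) + h * norm (b t x \<mu> - b t y \<mu>)"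
    proof -
      have "drift_map h b t \<mu> x - drift_map h b t \<mu> y = (x - y) + h *\<^sub>R (b t x \<mu> - b t y \<mu>)"
        by (simp add: drift_map_def algebra_simps)
      then show ?thesis
        using h norm_triangle_ineq[of "x - y" "h *\<^sub>R (b t x \<mu> - b t y \<mu>)"] by simp
    qed
    also have "\<dots> \<le> norm (x - y) + h * (L * norm (x - y))"
      using h regular_coefficient_lipschitz[OF b t \<mu>] by (intro add_left_mono mult_left_mono) auto
    finally show ?thesis by (simp add: algebra_simps)
  qed
  show "drift_map h b t \<mu> \<in> borel_measurable borel"
    by (intro borel_measurable_continuous_onI lipschitz_imp_continuous[OF lip])
  show "linear_growth (drift_map h b t \<mu>) norm"
    by (rule lipschitz_imp_linear_growth[OF lip _ norm_triangle_ineq]) (use h L in simp)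
qed

lemma diffusion_map_regular:
  assumes \<sigma>: "regular_coefficient T p \<rho> L L' op_norm (\<sigma> :: (real^'d, real^'q^'d) coefficient)"
  shows "diffusion_map h \<sigma> t \<mu> \<in> borel_measurable borel" and "linear_growth (diffusion_map h \<sigma> t \<mu>) op_norm"
proof -
  have lip: "op_norm (diffusion_map h \<sigma> t \<mu> x - diffusion_map h \<sigma> t \<mu> y) \<le> sqrt h * L * norm (x - y)" for x y
    using h mult_left_mono[OF regular_coefficient_lipschitz[OF \<sigma> t \<mu>, of x y], of "sqrt h"]
    by (simp add: diffusion_map_def op_norm_scaleR mult.assoc flip: scaleR_right_diff_distrib)
  show "linear_growth (diffusion_map h \<sigma> t \<mu>) op_norm"
    by (rule lipschitz_imp_linear_growth[OF lip _ op_norm_add_le]) (use h L in simp)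
  have "norm (diffusion_map h \<sigma> t \<mu> x - diffusion_map h \<sigma> t \<mu> y)
      \<le> (CARD('d) * CARD('q) * (sqrt h * L)) * norm (x - y)" for x y
    using order_trans[OF norm_matrix_le_op_norm mult_left_mono[OF lip]] by (simp add: mult.assoc)
  then show "diffusion_map h \<sigma> t \<mu> \<in> borel_measurable borel"
    by (intro borel_measurable_continuous_onI lipschitz_imp_continuous)
qed

end

lemma borel_measurable_matrix_vector_mult_joint [measurable (raw)]:
  fixes A :: "'a \<Rightarrow> real^'q^'d" and z :: "'a \<Rightarrow> real^'q"
  assumes [measurable]: "A \<in> borel_measurable M" "z \<in> borel_measurable M"
  shows "(\<lambda>\<omega>. A \<omega> *v z \<omega>) \<in> borel_measurable M"
proof -
  have "continuous_on UNIV (\<lambda>w. fst w *v snd w :: real^'d)"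
    unfolding matrix_vector_mult_def
    by (intro continuous_on_vec_lambda continuous_intros)
  then have "(\<lambda>w. fst w *v snd w) \<in> borel_measurable (borel :: ((real^'q^'d) \<times> (real^'q)) measure)"
    by (rule borel_measurable_continuous_onI)
  from measurable_compose[OF borel_measurable_Pair[OF assms] this] show ?thesis by simp
qed

section \<open>Integrating out one Gaussian step\<close>

context prob_space
begin

text \<open>The joint law of state and noise is a product, and the dominating function is a product
  of integrable factors.\<close>

lemma integrable_euler_step:
  fixes \<beta> :: "real^'d \<Rightarrow> real^'d" and S :: "real^'d \<Rightarrow> real^'q^'d"
    and X :: "'a \<Rightarrow> real^'d" and \<zeta> :: "'a \<Rightarrow> real^'q"
  assumes p: "0 \<le> p"
    and X[measurable]: "X \<in> borel_measurable M" and intX: "integrable M (\<lambda>\<omega>. norm (X \<omega>) powr p)"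
    and \<zeta>[measurable]: "\<zeta> \<in> borel_measurable M" and N: "distr M borel \<zeta> = std_normal_vec"
    and joint: "distr M (borel \<Otimes>\<^sub>M borel) (\<lambda>\<omega>. (X \<omega>, \<zeta> \<omega>)) = distr M borel X \<Otimes>\<^sub>M distr M borel \<zeta>"
    and [measurable]: "\<beta> \<in> borel_measurable borel" "S \<in> borel_measurable borel"
    and growth: "linear_growth \<beta> norm" "linear_growth S op_norm"
  shows "integrable M (\<lambda>\<omega>. norm (\<beta> (X \<omega>) + S (X \<omega>) *v \<zeta> \<omega>) powr p)"
proof -
  obtain c where c: "c \<ge> 0" "\<And>x z. norm (\<beta> x + S x *v z) powr p \<le> c * ((1 + norm x powr p) * (1 + norm z powr p))"
    using affine_step_powr_bound[OF growth p] by blast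
  have PN: "prob_space (std_normal_vec :: (real^'q) measure)"
    using prob_space_distr[OF \<zeta>] by (simp add: N)
  have PX: "prob_space (distr M borel X)" by (rule prob_space_distr[OF X])
  interpret D: prob_space "distr M borel \<zeta>" by (rule prob_space_distr[OF \<zeta>])
  interpret DX: prob_space "distr M borel X" by (rule PX)
  interpret Q: pair_sigma_finite "distr M borel X" "distr M borel \<zeta>" ..
  have i1: "integrable (distr M borel X) (\<lambda>x. 1 + norm x powr p)"
    using intX by (intro Bochner_Integration.integrable_add DX.integrable_const) (simp add: integrable_distr_eq)
  have i2: "integrable (distr M borel \<zeta>) (\<lambda>z. 1 + norm z powr p)"
    using integrable_norm_powr_std_normal_vec[OF PN p] unfolding N
    by (intro Bochner_Integration.integrable_add prob_space.finite_measure[OF PN, THEN finite_measure.integrable_const])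
  have "integrable (distr M borel X \<Otimes>\<^sub>M distr M borel \<zeta>) (\<lambda>(x, z). (1 + norm x powr p) * (1 + norm z powr p))"
  proof (rule Q.Fubini_integrable)
    show "integrable (distr M borel X) (\<lambda>x. \<integral>z. norm (case (x, z) of (x, z) \<Rightarrow>
        (1 + norm x powr p) * (1 + norm z powr p)) \<partial>distr M borel \<zeta>)"
      using i1 by (simp add: abs_mult add_nonneg_nonneg)
    show "AE x in distr M borel X. integrable (distr M borel \<zeta>)
        (\<lambda>z. case (x, z) of (x, z) \<Rightarrow> (1 + norm x powr p) * (1 + norm z powr p))"
      using i2 by (intro AE_I2) (simp only: prod.case integrable_mult_right)
  qed measurable
  then have "integrable M (\<lambda>\<omega>. (1 + norm (X \<omega>) powr p) * (1 + norm (\<zeta> \<omega>) powr p))"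
    unfolding joint[symmetric] by (subst (asm) integrable_distr_eq) auto
  then have "integrable M (\<lambda>\<omega>. c * ((1 + norm (X \<omega>) powr p) * (1 + norm (\<zeta> \<omega>) powr p)))"
    by (rule integrable_mult_right)
  then show ?thesis
    by (rule Bochner_Integration.integrable_bound)
      (auto intro!: AE_I2 order_trans[OF c(2) abs_ge_self])
qed

text \<open>Conditioning on the past takes the form of Fubini's theorem for the product law of past
  path and noise. The path is cut off after \<open>m\<close>, since the next state already involves
  the noise.\<close>

lemma expectation_gauss_step:
  fixes \<beta> :: "real^'d \<Rightarrow> real^'d" and S :: "real^'d \<Rightarrow> real^'q^'d"
    and X :: "nat \<Rightarrow> 'a \<Rightarrow> real^'d" and \<zeta> :: "'a \<Rightarrow> real^'q"
  assumes p: "0 \<le> p" and F: "path_functional (Suc m) p F"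
    and X[measurable]: "\<And>i. i \<le> Suc m \<Longrightarrow> X i \<in> borel_measurable M"
    and intX: "\<And>i. i \<le> Suc m \<Longrightarrow> integrable M (\<lambda>\<omega>. norm (X i \<omega>) powr p)"
    and \<zeta>[measurable]: "\<zeta> \<in> borel_measurable M" and N: "distr M borel \<zeta> = std_normal_vec"
    and joint: "distr M (borel \<Otimes>\<^sub>M borel) (\<lambda>\<omega>. (\<lambda>i. if i \<le> m then X i \<omega> else 0, \<zeta> \<omega>))
        = distr M borel (\<lambda>\<omega> i. if i \<le> m then X i \<omega> else 0) \<Otimes>\<^sub>M distr M borel \<zeta>"
    and [measurable]: "\<beta> \<in> borel_measurable borel" "S \<in> borel_measurable borel"
    and step: "\<And>\<omega>. X (Suc m) \<omega> = \<beta> (X m \<omega>) + S (X m \<omega>) *v \<zeta> \<omega>"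
  shows "integrable M (\<lambda>\<omega>. gauss_step m \<beta> S F (\<lambda>i. X i \<omega>))"
    and "(\<integral>\<omega>. F (\<lambda>i. X i \<omega>) \<partial>M) = (\<integral>\<omega>. gauss_step m \<beta> S F (\<lambda>i. X i \<omega>) \<partial>M)"
proof -
  define U where "U \<omega> = (\<lambda>i. if i \<le> m then X i \<omega> else 0)" for \<omega>
  define f where "f = (\<lambda>(x :: nat \<Rightarrow> real^'d, z :: real^'q). F (x(Suc m := \<beta> (x m) + S (x m) *v z)))"
  have U[measurable]: "U \<in> borel_measurable M"
    unfolding U_def
  proof (rule measurable_coordinatewise_then_product)
    show "(\<lambda>\<omega>. if i \<le> m then X i \<omega> else 0) \<in> borel_measurable M" for i by (cases "i \<le> m") auto
  qed
  have jointU: "distr M (borel \<Otimes>\<^sub>M borel) (\<lambda>\<omega>. (U \<omega>, \<zeta> \<omega>)) = distr M borel U \<Otimes>\<^sub>M distr M borel \<zeta>"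
    using joint by (simp add: U_def[abs_def])
  have [measurable]: "(\<lambda>x :: nat \<Rightarrow> real^'d. x i) \<in> borel_measurable borel" for i
    by (intro borel_measurable_continuous_onI continuous_on_product_coordinates)
  have f[measurable]: "f \<in> borel_measurable (borel \<Otimes>\<^sub>M borel)"
    unfolding f_def split_def
  proof (rule borel_measurable_path_functional[OF F p])
    show "(\<lambda>w. ((fst w)(Suc m := \<beta> (fst w m) + S (fst w m) *v snd w)) i) \<in> borel_measurable (borel \<Otimes>\<^sub>M borel)" for i
      by (cases "i = Suc m") auto
  qed
  have FU: "F (\<lambda>i. X i \<omega>) = f (U \<omega>, \<zeta> \<omega>)" for \<omega>
    unfolding f_def by (auto intro!: path_functional_cong[OF F] simp: U_def step)
  interpret D: prob_space "distr M borel \<zeta>" by (rule prob_space_distr[OF \<zeta>])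
  interpret DU: prob_space "distr M borel U" by (rule prob_space_distr[OF U])
  interpret Q: pair_sigma_finite "distr M borel U" "distr M borel \<zeta>" ..
  have "integrable M (\<lambda>\<omega>. F (\<lambda>i. X i \<omega>))"
    using X intX by (intro integrable_path_functional[OF F p finite_measure_axioms])
  then have int: "integrable (distr M borel U \<Otimes>\<^sub>M distr M borel \<zeta>) f"
    unfolding jointU[symmetric] FU by (subst integrable_distr_eq) auto
  have GU: "gauss_step m \<beta> S F (U \<omega>) = gauss_step m \<beta> S F (\<lambda>i. X i \<omega>)" for \<omega>
  proof -
    have "F ((U \<omega>)(Suc m := w)) = F ((\<lambda>i. X i \<omega>)(Suc m := w))" for w
      by (intro path_functional_cong[OF F]) (auto simp: U_def le_Suc_eq)
    then show ?thesis by (simp add: gauss_step_def U_def)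
  qed
  have Gf: "gauss_step m \<beta> S F x = (\<integral>z. f (x, z) \<partial>distr M borel \<zeta>)" for x
    by (simp add: N f_def gauss_step_def)
  have meas: "gauss_step m \<beta> S F \<in> borel_measurable borel"
    unfolding Gf[abs_def] by measurable
  have "integrable (distr M borel U) (gauss_step m \<beta> S F)"
    unfolding Gf[abs_def] by (rule Q.integrable_fst'[OF int])
  then show "integrable M (\<lambda>\<omega>. gauss_step m \<beta> S F (\<lambda>i. X i \<omega>))"
    unfolding integrable_distr_eq[OF U meas] GU .
  have "(\<integral>\<omega>. F (\<lambda>i. X i \<omega>) \<partial>M) = integral\<^sup>L (distr M (borel \<Otimes>\<^sub>M borel) (\<lambda>\<omega>. (U \<omega>, \<zeta> \<omega>))) f"
    unfolding FU by (subst integral_distr) auto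
  also have "\<dots> = (\<integral>x. (\<integral>z. f (x, z) \<partial>distr M borel \<zeta>) \<partial>distr M borel U)"
    unfolding jointU by (rule Q.integral_fst'[symmetric, OF int])
  also have "\<dots> = (\<integral>x. gauss_step m \<beta> S F x \<partial>distr M borel U)"
    by (simp add: N f_def gauss_step_def)
  also have "\<dots> = (\<integral>\<omega>. gauss_step m \<beta> S F (U \<omega>) \<partial>M)"
    by (rule integral_distr[OF U meas])
  finally show "(\<integral>\<omega>. F (\<lambda>i. X i \<omega>) \<partial>M) = (\<integral>\<omega>. gauss_step m \<beta> S F (\<lambda>i. X i \<omega>) \<partial>M)"
    by (simp only: GU)
qed

end

text \<open>This passes from extensional paths to total ones. Restricting the argument keeps it
  inside \<open>path_space\<close>, where alone \<open>F\<close> is controlled, and the maximum of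
  the powers is at most their sum.\<close>

lemma path_functional_restrict:
  assumes F: "convex_on_paths m F" and growth: "poly_growth_on_paths m p F"
  shows "path_functional m p (\<lambda>x. F (\<lambda>i\<in>{..m}. x i))"
  unfolding path_functional_def
proof (intro conjI allI impI ballI)
  have ps: "(\<lambda>i\<in>{..m}. x i) \<in> path_space m" for x :: "nat \<Rightarrow> 'a" by (simp add: path_space_def)
  fix x y :: "nat \<Rightarrow> 'a"
  show "F (\<lambda>i\<in>{..m}. x i) = F (\<lambda>i\<in>{..m}. y i)" if "\<forall>i\<le>m. x i = y i"
    using that by (intro arg_cong[where f=F] restrict_ext) simp
  fix u :: real assume u: "u \<in> {0..1}"
  have "(\<lambda>i\<in>{..m}. u *\<^sub>R x i + (1 - u) *\<^sub>R y i)
      = (\<lambda>i\<in>{..m}. u *\<^sub>R (\<lambda>i\<in>{..m}. x i) i + (1 - u) *\<^sub>R (\<lambda>i\<in>{..m}. y i) i)"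
    by (intro restrict_ext) simp
  then show "F (\<lambda>i\<in>{..m}. u *\<^sub>R x i + (1 - u) *\<^sub>R y i)
      \<le> u * F (\<lambda>i\<in>{..m}. x i) + (1 - u) * F (\<lambda>i\<in>{..m}. y i)"
    using F u ps[of x] ps[of y] by (simp only: convex_on_paths_def)
next
  obtain C where C: "C > 0" "\<And>x. x \<in> path_space m \<Longrightarrow> \<bar>F x\<bar> \<le> C * (1 + (MAX i\<in>{..m}. norm (x i) powr p))"
    using growth by (auto simp: poly_growth_on_paths_def)
  show "\<exists>C\<ge>0. \<forall>x. \<bar>F (\<lambda>i\<in>{..m}. x i)\<bar> \<le> C * (1 + (\<Sum>i\<le>m. norm (x i) powr p))"
  proof (intro exI conjI allI)
    show "0 \<le> C" using C by simp
    fix x :: "nat \<Rightarrow> 'a"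
    let ?x = "\<lambda>i\<in>{..m}. x i"
    have "\<bar>F ?x\<bar> \<le> C * (1 + (MAX i\<in>{..m}. norm (?x i) powr p))"
      by (rule C(2)) (simp add: path_space_def)
    also have "(MAX i\<in>{..m}. norm (?x i) powr p) \<le> (\<Sum>i\<le>m. norm (x i) powr p)"
      by (subst Max_le_iff) (auto intro!: member_le_sum)
    finally show "\<bar>F ?x\<bar> \<le> C * (1 + (\<Sum>i\<le>m. norm (x i) powr p))"
      using C(1) by (simp add: mult_left_mono)
  qed
qed

text \<open>Through these functionals the comparison of path expectations yields the convex order of
  the laws at time index \<open>m\<close>. Linear growth is dominated by growth \<open>p\<close>
  because \<open>t \<le> 1 + t powr p\<close>.\<close>

lemma path_functional_last:
  assumes \<psi>: "convex_on UNIV \<psi>" "\<And>x. \<bar>\<psi> x\<bar> \<le> c * (1 + norm x)" and p: "1 \<le> p"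
  shows "path_functional m p (\<lambda>x. \<psi> (x m))"
  unfolding path_functional_def
proof (intro conjI allI impI ballI)
  fix x y :: "nat \<Rightarrow> 'a" and u :: real
  show "\<psi> (u *\<^sub>R x m + (1 - u) *\<^sub>R y m) \<le> u * \<psi> (x m) + (1 - u) * \<psi> (y m)" if "u \<in> {0..1}"
    using convex_onD[OF \<psi>(1), of "1 - u" "x m" "y m"] that by simp
next
  have c: "0 \<le> c" using \<psi>(2)[of 0] by simp
  show "\<exists>C\<ge>0. \<forall>x. \<bar>\<psi> (x m)\<bar> \<le> C * (1 + (\<Sum>i\<le>m. norm (x i) powr p))"
  proof (intro exI conjI allI)
    show "0 \<le> 2 * c" using c by simp
    fix x :: "nat \<Rightarrow> 'a"
    have "norm (x m) \<le> 1 + norm (x m) powr p"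
      using p powr_mono[of 1 p "norm (x m)"] by (cases "norm (x m) \<le> 1") (auto simp: add_increasing2)
    also have "norm (x m) powr p \<le> (\<Sum>i\<le>m. norm (x i) powr p)"
      by (intro member_le_sum) auto
    finally have "c * (1 + norm (x m)) \<le> c * (2 * (1 + (\<Sum>i\<le>m. norm (x i) powr p)))"
      using c sum_nonneg[of "{..m}" "\<lambda>i. norm (x i) powr p"] by (intro mult_left_mono) auto
    then show "\<bar>\<psi> (x m)\<bar> \<le> 2 * c * (1 + (\<Sum>i\<le>m. norm (x i) powr p))"
      using \<psi>(2)[of "x m"] by (simp add: mult_ac)
  qed
qed auto

text \<open>A functional that depends on coordinate 0 only is recovered from its values on constant
  paths; this brings the start of the induction under the convex order of the initial laws.\<close>

lemma convex_path_functional_0: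
  assumes F: "path_functional 0 p F"
  shows "convex_on UNIV (\<lambda>w. F (\<lambda>_. w))"
proof (rule convex_onI)
  fix t :: real and x y :: 'a assume "0 < t" "t < 1"
  then show "F (\<lambda>_. (1 - t) *\<^sub>R x + t *\<^sub>R y) \<le> (1 - t) * F (\<lambda>_. x) + t * F (\<lambda>_. y)"
    using path_functional_convex[OF F, of "1 - t" "\<lambda>_. x" "\<lambda>_. y"] by simp
qed simp

lemma convex_diffusion_map:
  assumes "\<sigma> t (u *\<^sub>R x + (1 - u) *\<^sub>R y) \<mu> \<preceq>mat u *\<^sub>R \<sigma> t x \<mu> + (1 - u) *\<^sub>R \<sigma> t y \<mu>"
  shows "diffusion_map h \<sigma> t \<mu> (u *\<^sub>R x + (1 - u) *\<^sub>R y)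
     \<preceq>mat u *\<^sub>R diffusion_map h \<sigma> t \<mu> x + (1 - u) *\<^sub>R diffusion_map h \<sigma> t \<mu> y"
  using matrix_order_scaleR[OF assms, of "sqrt h"]
  by (simp add: diffusion_map_def scaleR_right_distrib mult.commute)

text \<open>The data common to both schemes. The diffusion coefficient and the initial value stay
  parameters of the facts below, which are used once with \<open>\<sigma>\<close> and once with
  \<open>\<theta>\<close>.\<close>

locale euler_setting = prob_space P for P :: "'w measure" +
  fixes V :: "'w \<Rightarrow> (real^'d) \<times> (real^'d)" and Z :: "nat \<Rightarrow> 'w \<Rightarrow> real^'q" and M :: nat
    and T p \<rho> L L' h :: real and b :: "(real^'d, real^'d) coefficient"
  assumes p: "1 \<le> p" and h: "0 \<le> h" "real M * h = T" and L: "0 \<le> L"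
    and ind: "indep_sets (noise_events P V Z) {0..M}"
    and Z: "\<And>m. m \<in> {1..M} \<Longrightarrow> random_variable borel (Z m)"
    and Z_normal: "\<And>m. m \<in> {1..M} \<Longrightarrow> distr P borel (Z m) = std_normal_vec"
    and b: "regular_coefficient T p \<rho> L L' norm b"
begin

lemma time: "m \<le> M \<Longrightarrow> 0 \<le> real m * h \<and> real m * h \<le> T"
  using mult_right_mono[of "real m" "real M" h] h by simp

lemma sets_history_events: "m \<le> M \<Longrightarrow> sets (history P V Z m) \<subseteq> events"
proof -
  assume m: "m \<le> M"
  have "noise_events P V Z i \<subseteq> events" if "i \<le> m" for i
    using ind m that unfolding indep_sets_def by simp
  then show ?thesis
    unfolding sets_history by (intro sets.sigma_sets_subset UN_least) simp
qed

lemma adapted_measurable: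
  "m \<le> M \<Longrightarrow> X \<in> measurable (history P V Z m) S \<Longrightarrow> X \<in> measurable P S"
  using sets_history_events[of m] by (auto simp: measurable_def)

lemma law_prob_moment:
  assumes "X \<in> borel_measurable P" "integrable P (\<lambda>\<omega>. norm (X \<omega>) powr p)"
  shows "distr P borel X \<in> prob_moment p"
  using assms prob_space_distr[of X borel] by (simp add: prob_moment_def integrable_distr_eq)

lemma joint_law:
  assumes "m < M" "U \<in> measurable (history P V Z m) S"
  shows "distr P (S \<Otimes>\<^sub>M borel) (\<lambda>\<omega>. (U \<omega>, Z (Suc m) \<omega>)) = distr P S U \<Otimes>\<^sub>M distr P borel (Z (Suc m))"
  using assms Z[of "Suc m"] by (intro distr_history_noise[OF ind] sets_history_events) auto

context
  fixes \<sigma> :: "(real^'d, real^'q^'d) coefficient" and X0 :: "'w \<Rightarrow> real^'d"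
  assumes \<sigma>: "regular_coefficient T p \<rho> L L' op_norm \<sigma>"
    and X0: "X0 \<in> borel_measurable (history P V Z 0)" "integrable P (\<lambda>\<omega>. norm (X0 \<omega>) powr p)"
begin

abbreviation "X \<equiv> euler_scheme P h b \<sigma> X0 Z"
abbreviation "\<beta> m \<equiv> drift_map h b (real m * h) (distr P borel (X m))"
abbreviation "S m \<equiv> diffusion_map h \<sigma> (real m * h) (distr P borel (X m))"

text \<open>Adaptedness and moments are proved together: the coefficients of the next step are
  regular only if the current law is in \<open>prob_moment p\<close>, and the moment of the next
  state needs the current state to be independent of the next noise.\<close>

lemma euler_scheme_adapted:
  assumes "m \<le> M"
  shows "X m \<in> borel_measurable (history P V Z m) \<and> integrable P (\<lambda>\<omega>. norm (X m \<omega>) powr p)"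
  using assms
proof (induction m)
  case 0
  then show ?case using X0 by simp
next
  case (Suc m)
  then have IH: "X m \<in> borel_measurable (history P V Z m)" "integrable P (\<lambda>\<omega>. norm (X m \<omega>) powr p)"
    and m: "m \<le> M" "m < M" by auto
  have XP: "X m \<in> borel_measurable P" using adapted_measurable[OF m(1) IH(1)] .
  have \<mu>: "distr P borel (X m) \<in> prob_moment p" using law_prob_moment[OF XP IH(2)] .
  note time' = time[OF m(1), THEN conjunct1] time[OF m(1), THEN conjunct2]
  note \<beta> = drift_map_regular[OF time' \<mu> L h(1) b]
  note S = diffusion_map_regular[OF time' \<mu> L h(1) \<sigma>]
  note [measurable] = \<beta>(1) S(1) measurable_history_mono[OF le_SucI[OF order_refl] IH(1)]
    measurable_history_noise[of "Suc m" "Suc m" Z P V, simplified]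
  have eq: "X (Suc m) = (\<lambda>\<omega>. \<beta> m (X m \<omega>) + S m (X m \<omega>) *v Z (Suc m) \<omega>)"
    by (rule ext) (simp only: euler_scheme_Suc Let_def)
  have "X (Suc m) \<in> borel_measurable (history P V Z (Suc m))"
    unfolding eq by measurable
  moreover have "integrable P (\<lambda>\<omega>. norm (X (Suc m) \<omega>) powr p)"
    unfolding eq using p Z[of "Suc m"] Z_normal[of "Suc m"] Suc.prems
    by (intro integrable_euler_step XP IH(2) \<beta> S joint_law[OF m(2) IH(1)]) auto
  ultimately show ?case ..
qed

lemma euler_scheme_measurable: "m \<le> M \<Longrightarrow> X m \<in> borel_measurable P"
  using euler_scheme_adapted adapted_measurable by blast

lemma euler_scheme_integrable: "m \<le> M \<Longrightarrow> integrable P (\<lambda>\<omega>. norm (X m \<omega>) powr p)"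
  using euler_scheme_adapted by blast

lemma euler_scheme_law: "m \<le> M \<Longrightarrow> distr P borel (X m) \<in> prob_moment p"
  by (intro law_prob_moment euler_scheme_measurable euler_scheme_integrable)

lemma integrable_path_functional_euler:
  assumes "m \<le> M" "path_functional m p F"
  shows "integrable P (\<lambda>\<omega>. F (\<lambda>i. X i \<omega>))"
  using assms p
  by (intro integrable_path_functional[OF assms(2) _ finite_measure_axioms]
      euler_scheme_measurable euler_scheme_integrable) auto

lemma euler_scheme_step:
  assumes m: "m < M" and F: "path_functional (Suc m) p F"
  shows "integrable P (\<lambda>\<omega>. gauss_step m (\<beta> m) (S m) F (\<lambda>i. X i \<omega>))"
    and "(\<integral>\<omega>. F (\<lambda>i. X i \<omega>) \<partial>P) = (\<integral>\<omega>. gauss_step m (\<beta> m) (S m) F (\<lambda>i. X i \<omega>) \<partial>P)"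
proof -
  have m': "m \<le> M" using m by simp
  note time' = time[OF m', THEN conjunct1] time[OF m', THEN conjunct2]
  note \<mu> = euler_scheme_law[OF m']
  note \<beta> = drift_map_regular[OF time' \<mu> L h(1) b]
  note S = diffusion_map_regular[OF time' \<mu> L h(1) \<sigma>]
  have U: "(\<lambda>\<omega> i. if i \<le> m then X i \<omega> else 0) \<in> borel_measurable (history P V Z m)"
  proof (rule measurable_coordinatewise_then_product)
    show "(\<lambda>\<omega>. if i \<le> m then X i \<omega> else 0) \<in> borel_measurable (history P V Z m)" for i
      using euler_scheme_adapted[of i] m measurable_history_mono[of i m] by (cases "i \<le> m") auto
  qed
  have p0: "0 \<le> p" using p by simp
  have Z1: "random_variable borel (Z (Suc m))" "distr P borel (Z (Suc m)) = std_normal_vec"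
    using Z[of "Suc m"] Z_normal[of "Suc m"] m by auto
  have X1: "X i \<in> borel_measurable P" "integrable P (\<lambda>\<omega>. norm (X i \<omega>) powr p)" if "i \<le> Suc m" for i
    using that m euler_scheme_measurable euler_scheme_integrable by auto
  have step: "X (Suc m) \<omega> = \<beta> m (X m \<omega>) + S m (X m \<omega>) *v Z (Suc m) \<omega>" for \<omega>
    by (simp only: euler_scheme_Suc Let_def)
  note * = expectation_gauss_step[OF p0 F X1 Z1 joint_law[OF m U] \<beta>(1) S(1) step]
  show "integrable P (\<lambda>\<omega>. gauss_step m (\<beta> m) (S m) F (\<lambda>i. X i \<omega>))" by (rule *(1))
  show "(\<integral>\<omega>. F (\<lambda>i. X i \<omega>) \<partial>P) = (\<integral>\<omega>. gauss_step m (\<beta> m) (S m) F (\<lambda>i. X i \<omega>) \<partial>P)" by (rule *(2))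
qed

end

end

theorem proposition4p1:
  fixes P :: "'w measure"
    and T p \<rho> L L' h :: real
    and M :: nat
    and b :: "(real ^ 'd, real ^ 'd) coefficient"
    and \<sigma> \<theta> :: "(real ^ 'd, real ^ 'q ^ 'd) coefficient"
    and X0 Y0 :: "'w \<Rightarrow> real ^ 'd"
    and Z :: "nat \<Rightarrow> 'w \<Rightarrow> real ^ 'q"
    and Xbar Ybar :: "nat \<Rightarrow> 'w \<Rightarrow> real ^ 'd"
    and F :: "(nat \<Rightarrow> real ^ 'd) \<Rightarrow> real"
  assumes "prob_space P"
    and "T > 0" and "M \<ge> 1" and "p \<ge> 2"
    and "X0 \<in> borel_measurable P" and "integrable P (\<lambda>\<omega>. norm (X0 \<omega>) powr p)"
    and "Y0 \<in> borel_measurable P" and "integrable P (\<lambda>\<omega>. norm (Y0 \<omega>) powr p)"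
    and I_const: "0 < \<rho>" "\<rho> \<le> 1" "L > 0" "L' > 0"
    and I_b: "regular_coefficient T p \<rho> L L' norm b"
    and I_\<sigma>: "regular_coefficient T p \<rho> L L' op_norm \<sigma>"
    and I_\<theta>: "regular_coefficient T p \<rho> L L' op_norm \<theta>"
    and II_1_affine: "\<And>t \<mu>. t \<in> {0..T} \<Longrightarrow> \<mu> \<in> prob_moment p \<Longrightarrow> affine_fun (\<lambda>x. b t x \<mu>)"
    and II_1_cv: "\<And>t x \<mu> \<nu>. t \<in> {0..T} \<Longrightarrow> \<mu> \<in> prob_moment p \<Longrightarrow> \<nu> \<in> prob_moment p \<Longrightarrow>
           \<mu> \<preceq>cv \<nu> \<Longrightarrow> b t x \<mu> = b t x \<nu>"
    and II_2: "\<And>t x y \<mu> u. t \<in> {0..T} \<Longrightarrow> \<mu> \<in> prob_moment p \<Longrightarrow> u \<in> {0..1} \<Longrightarrow>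
           \<sigma> t (u *\<^sub>R x + (1 - u) *\<^sub>R y) \<mu> \<preceq>mat u *\<^sub>R \<sigma> t x \<mu> + (1 - u) *\<^sub>R \<sigma> t y \<mu>"
    and II_3: "\<And>t x \<mu> \<nu>. t \<in> {0..T} \<Longrightarrow> \<mu> \<in> prob_moment p \<Longrightarrow> \<nu> \<in> prob_moment p \<Longrightarrow>
           \<mu> \<preceq>cv \<nu> \<Longrightarrow> \<sigma> t x \<mu> \<preceq>mat \<sigma> t x \<nu>"
    and II_4: "\<And>t x \<mu>. t \<in> {0..T} \<Longrightarrow> \<mu> \<in> prob_moment p \<Longrightarrow> \<sigma> t x \<mu> \<preceq>mat \<theta> t x \<mu>"
    and II_5: "distr P borel X0 \<preceq>cv distr P borel Y0"
    and Z_indep: "prob_space.indep_vars P (\<lambda>_. borel) Z {1..M}"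
    and Z_normal: "\<And>m. m \<in> {1..M} \<Longrightarrow> distr P borel (Z m) = std_normal_vec"
    and Z_indep_init: "indep_pair P
           (borel \<Otimes>\<^sub>M borel) (\<lambda>\<omega>. (X0 \<omega>, Y0 \<omega>))
           (PiM {1..M} (\<lambda>_. borel)) (\<lambda>\<omega>. \<lambda>m\<in>{1..M}. Z m \<omega>)"
    and h: "h = T / real M"
    and Xbar: "Xbar = euler_scheme P h b \<sigma> X0 Z"
    and Ybar: "Ybar = euler_scheme P h b \<theta> Y0 Z"
    and F_convex: "convex_on_paths M F"
    and F_growth: "poly_growth_on_paths M p F"
  shows "integrable P (\<lambda>\<omega>. F (\<lambda>m\<in>{..M}. Xbar m \<omega>)) \<and>
         integrable P (\<lambda>\<omega>. F (\<lambda>m\<in>{..M}. Ybar m \<omega>)) \<and>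
         (\<integral>\<omega>. F (\<lambda>m\<in>{..M}. Xbar m \<omega>) \<partial>P) \<le> (\<integral>\<omega>. F (\<lambda>m\<in>{..M}. Ybar m \<omega>) \<partial>P)"
proof -
  interpret prob_space P by fact
  have Zm: "random_variable borel (Z m)" if "m \<in> {1..M}" for m
    using Z_indep that by (auto simp: indep_vars_def2)
  let ?V = "\<lambda>\<omega>. (X0 \<omega>, Y0 \<omega>)"
  have hM: "real M * h = T" "0 \<le> h" using h \<open>T > 0\<close> \<open>M \<ge> 1\<close> by auto
  \<comment> \<open>Both initial values belong to the 0-th noise, so the two schemes are adapted to
    the same filtration.\<close>
  interpret euler_setting P ?V Z M T p \<rho> L L' h b
    using \<open>p \<ge> 2\<close> hM \<open>L > 0\<close> I_b Zm Z_normal indep_sets_noise_events[OF Z_indep Z_indep_init]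
    by unfold_locales auto
  have "?V \<in> measurable (history P ?V Z 0) (borel \<Otimes>\<^sub>M borel)" by (rule measurable_history_init)
  from measurable_compose[OF this measurable_fst] measurable_compose[OF this measurable_snd]
  have init: "X0 \<in> borel_measurable (history P ?V Z 0)" "Y0 \<in> borel_measurable (history P ?V Z 0)"
    by simp_all
  note X_setting = I_\<sigma> init(1) \<open>integrable P (\<lambda>\<omega>. norm (X0 \<omega>) powr p)\<close>
  note Y_setting = I_\<theta> init(2) \<open>integrable P (\<lambda>\<omega>. norm (Y0 \<omega>) powr p)\<close>
  have p0: "0 \<le> p" "1 \<le> p" using \<open>p \<ge> 2\<close> by auto
  note intX = integrable_path_functional_euler[OF X_setting, folded Xbar]
  note intY = integrable_path_functional_euler[OF Y_setting, folded Ybar]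
  define \<mu> where "\<mu> m = distr P borel (Xbar m)" for m
  define \<nu> where "\<nu> m = distr P borel (Ybar m)" for m
  note lawX = euler_scheme_law[OF X_setting, folded Xbar, folded \<mu>_def]
  note lawY = euler_scheme_law[OF Y_setting, folded Ybar, folded \<nu>_def]
  note stepX = euler_scheme_step[OF X_setting, folded Xbar, folded \<mu>_def]
  note stepY = euler_scheme_step[OF Y_setting, folded Ybar, folded \<nu>_def]
  note measX = euler_scheme_measurable[OF X_setting, folded Xbar]
  note measY = euler_scheme_measurable[OF Y_setting, folded Ybar]
  have main: "(\<integral>\<omega>. G (\<lambda>i. Xbar i \<omega>) \<partial>P) \<le> (\<integral>\<omega>. G (\<lambda>i. Ybar i \<omega>) \<partial>P)"
    if "m \<le> M" "path_functional m p G" for m G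
    using that
  \<comment> \<open>The induction hypothesis is applied to two kinds of functionals: those of the
    last coordinate, which order the laws, and \<open>?H\<close>.\<close>
  proof (induction m arbitrary: G)
    case (0 G)
    let ?\<phi> = "\<lambda>w. G (\<lambda>_. w)"
    have \<phi>: "convex_on UNIV ?\<phi>" using convex_path_functional_0[OF 0(2)] .
    note [measurable] = borel_measurable_convex[OF \<phi>] \<open>X0 \<in> borel_measurable P\<close> \<open>Y0 \<in> borel_measurable P\<close>
    have eq: "G (\<lambda>i. Xbar i \<omega>) = ?\<phi> (X0 \<omega>)" "G (\<lambda>i. Ybar i \<omega>) = ?\<phi> (Y0 \<omega>)" for \<omega>
      by (auto intro!: path_functional_cong[OF 0(2)] simp: Xbar Ybar)
    have "integral\<^sup>L (distr P borel X0) ?\<phi> \<le> integral\<^sup>L (distr P borel Y0) ?\<phi>"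
      using II_5 \<phi> intX[OF 0] intY[OF 0] unfolding eq
      by (intro convex_order_integral) (simp_all add: integrable_distr_eq)
    then show ?case unfolding eq by (simp add: integral_distr)
  next
    case (Suc m G)
    then have m: "m < M" "m \<le> M" and G: "path_functional (Suc m) p G" by auto
    let ?t = "real m * h"
    have t: "?t \<in> {0..T}" using time[OF m(2)] by simp
    have cv: "\<mu> m \<preceq>cv \<nu> m"
    proof (rule convex_orderI)
      show "\<mu> m \<in> prob_moment 1" "\<nu> m \<in> prob_moment 1"
        by (intro prob_moment_mono[OF p0(2)] lawX[OF m(2)] lawY[OF m(2)])+
      fix \<psi> :: "real^'d \<Rightarrow> real" and c
      assume \<psi>: "convex_on UNIV \<psi>" "\<And>x. \<bar>\<psi> x\<bar> \<le> c * (1 + norm x)"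
      note [measurable] = borel_measurable_convex[OF \<psi>(1)] measX[OF m(2)] measY[OF m(2)]
      show "integral\<^sup>L (\<mu> m) \<psi> \<le> integral\<^sup>L (\<nu> m) \<psi>"
        using Suc.IH[OF m(2) path_functional_last[OF \<psi> p0(2)]]
        by (simp add: \<mu>_def \<nu>_def integral_distr)
    qed
    \<comment> \<open>The order of the laws just obtained makes the two drift maps coincide, so that
      a single \<open>?\<beta>\<close> serves both schemes.\<close>
    have "b ?t x (\<mu> m) = b ?t x (\<nu> m)" for x
      using II_1_cv[OF t] lawX lawY m cv by blast
    then have drift: "drift_map h b ?t (\<mu> m) = drift_map h b ?t (\<nu> m)"
      by (simp add: drift_map_def fun_eq_iff)
    let ?\<beta> = "drift_map h b ?t (\<mu> m)"
    \<comment> \<open>Two moves at a fixed state: from the law of X to that of Y within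
      \<open>\<sigma>\<close>, and from \<open>\<sigma>\<close> to \<open>\<theta>\<close> under the
      law of Y.\<close>
    have order: "diffusion_map h \<sigma> ?t (\<mu> m) x \<preceq>mat diffusion_map h \<theta> ?t (\<nu> m) x" for x
      using matrix_order_trans[OF II_3[OF t lawX lawY cv] II_4[OF t lawY]] m
      by (simp add: diffusion_map_def matrix_order_scaleR)
    \<comment> \<open>As \<open>M\<close> is at least 1, the standard normal measure is the law of
      some \<open>Z m\<close> and hence has total mass 1.\<close>
    have N: "prob_space (std_normal_vec :: (real^'q) measure)"
      using prob_space_distr[OF Zm] Z_normal \<open>M \<ge> 1\<close> by (metis atLeastAtMost_iff order_refl)
    note time' = time[OF m(2), THEN conjunct1] time[OF m(2), THEN conjunct2]
    let ?H = "gauss_step m ?\<beta> (diffusion_map h \<sigma> ?t (\<mu> m)) G"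
    have H: "path_functional m p ?H"
    proof (rule path_functional_gauss_step[OF N p0(1) G])
      show "affine_fun ?\<beta>" by (intro affine_drift_map II_1_affine t lawX m)
      show "linear_growth ?\<beta> norm"
        by (rule drift_map_regular(2)[OF time' lawX[OF m(2)] L hM(2) I_b])
      show "linear_growth (diffusion_map h \<sigma> ?t (\<mu> m)) op_norm"
        by (rule diffusion_map_regular(2)[OF time' lawX[OF m(2)] L hM(2) I_\<sigma>])
    qed (intro convex_diffusion_map II_2 t lawX m)
    have "(\<integral>\<omega>. G (\<lambda>i. Xbar i \<omega>) \<partial>P) = (\<integral>\<omega>. ?H (\<lambda>i. Xbar i \<omega>) \<partial>P)"
      by (rule stepX(2)[OF m(1) G])
    \<comment> \<open>\<open>?H\<close> still carries \<open>\<sigma>\<close> and the law of X while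
      it is evaluated along Y: the intermediate expectation belongs to neither scheme.\<close>
    also have "\<dots> \<le> (\<integral>\<omega>. ?H (\<lambda>i. Ybar i \<omega>) \<partial>P)"
      by (rule Suc.IH[OF m(2) H])
    also have "\<dots> \<le> (\<integral>\<omega>. gauss_step m ?\<beta> (diffusion_map h \<theta> ?t (\<nu> m)) G (\<lambda>i. Ybar i \<omega>) \<partial>P)"
    proof (rule integral_mono[OF intY[OF m(2) H]])
      show "integrable P (\<lambda>\<omega>. gauss_step m ?\<beta> (diffusion_map h \<theta> ?t (\<nu> m)) G (\<lambda>i. Ybar i \<omega>))"
        unfolding drift by (rule stepY(1)[OF m(1) G])
      show "?H y \<le> gauss_step m ?\<beta> (diffusion_map h \<theta> ?t (\<nu> m)) G y" for y
        by (rule gauss_step_mono[OF N p0(1) G]) (rule order)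
    qed
    also have "\<dots> = (\<integral>\<omega>. G (\<lambda>i. Ybar i \<omega>) \<partial>P)"
      unfolding drift by (rule stepY(2)[OF m(1) G, symmetric])
    finally show ?case .
  qed
  have F: "path_functional M p (\<lambda>x. F (\<lambda>i\<in>{..M}. x i))"
    by (rule path_functional_restrict[OF F_convex F_growth])
  show ?thesis
    using intX[OF order_refl F] intY[OF order_refl F] main[OF order_refl F] by simp
qed

end
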